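(* Let $p$ be a prime, $(I,<)$ a well-ordered set, $S$ a free pro-$p$ group with basis $(x_i)_{i\in I}$, and $\mathcal R$ a set of elements of $S_{(2)}$. Assume there exist $r\in\mathcal R$ and distinct $i<j$ in $I$ such that: (1) in the canonical decomposition modulo $S_{(4)}$ of $r$, $u_{ij}=u_{il}=u_{jl}=0$ for all $l\ne i,j$, $c_{iji}\ne0$ (respectively $c_{ijj}\ne0$), and if $p=2$ also $a_i=a_j=0$; (2) for every $s\in\mathcal R$ different from $r$, the factor $[x_i,x_j]$ does not occur in the canonical decomposition modulo $S_{(4)}$ of $s$, and if $p=2$, also $x_i^2$ (respectively $x_j^2$) does not occur in it. Then $G=S/\langle\mathcal R\rangle$ does not have the vanishing triple Massey product property with respect to $\mathbb{F}_p$.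
   Context: $[x,y]=x^{-1}y^{-1}xy$; $p$-Zassenhaus filtration $S_{(1)}=S$, $S_{(m)}=S_{(\lceil m/p\rceil)}^p\prod_{a+b=m}[S_{(a)},S_{(b)}]$; $\langle\mathcal R\rangle$ is the closed normal subgroup generated by $\mathcal R$. Canonical decomposition modulo $S_{(4)}$ of $r\in S_{(2)}$: the unique expression (products in a fixed order) $\prod_{i}x_i^{2a_i}\prod_{i<j}[x_i,x_j]^{b_{ij}}\prod_{i<j,k\le j}[[x_i,x_j],x_k]^{c_{ijk}}r'$ if $p=2$; $\prod_{i<j}[x_i,x_j]^{b_{ij}}\prod_{i}x_i^{3a_i}\prod_{i<j,k\le j}[[x_i,x_j],x_k]^{c_{ijk}}r'$ if $p=3$; $\prod_{i<j}[x_i,x_j]^{b_{ij}}\prod_{i<j,k\le j}[[x_i,x_j],x_k]^{c_{ijk}}r'$ if $p>3$; $a_i,b_{ij},c_{ijk}\in\{0,\dots,p-1\}$, $r'\in S_{(4)}$; a factor does not occur if its exponent is $0$. $u_{ij}=b_{ij}$ if $i<j$, $u_{ij}=b_{ji}$ if $j<i$. A profinite group has the vanishing triple Massey product property w.r.t. $\mathbb{F}_p$ if every defined triple Massey product $\langle\alpha_1,\alpha_2,\alpha_3\rangle$, $\alpha_i\in H^1(G,\mathbb{F}_p)$, contains $0$, where (in the DGA of inhomogeneous continuous cochains) a defining system is $(a_{ij})$, $1\le i<j\le4$, $(i,j)\ne(1,4)$, with $a_{i,i+1}$ representing $\alpha_i$, $\partial a_{13}=a_{12}\cup a_{23}$,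 $\partial a_{24}=a_{23}\cup a_{34}$, the value is the class of $a_{12}\cup a_{24}+a_{13}\cup a_{34}$, and the product is the set of values (defined if nonempty). *)

theory Defs
  imports "HOL-Analysis.Analysis" "HOL-Algebra.Generated_Groups" "HOL-Number_Theory.Residues"
begin

section \<open>Profinite and pro-$p$ groups\<close>

definition topological_group :: "('a, 'm) monoid_scheme \<Rightarrow> 'a topology \<Rightarrow> bool" where
  "topological_group G T \<longleftrightarrow>
     group G \<and> topspace T = carrier G \<and>
     continuous_map (prod_topology T T) T (\<lambda>(g, h). g \<otimes>\<^bsub>G\<^esub> h) \<and>
     continuous_map T T (\<lambda>g. inv\<^bsub>G\<^esub> g)"

definition profinite_group :: "('a, 'm) monoid_scheme \<Rightarrow> 'a topology \<Rightarrow> bool" where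
  "profinite_group G T \<longleftrightarrow>
     topological_group G T \<and> compact_space T \<and> Hausdorff_space T \<and>
     (\<forall>C. connectedin T C \<longrightarrow> (\<exists>g. C \<subseteq> {g}))"

definition pro_p_group :: "nat \<Rightarrow> ('a, 'm) monoid_scheme \<Rightarrow> 'a topology \<Rightarrow> bool" where
  "pro_p_group p G T \<longleftrightarrow>
     profinite_group G T \<and>
     (\<forall>N. N \<lhd> G \<and> openin T N \<longrightarrow> (\<exists>k::nat. card (rcosets\<^bsub>G\<^esub> N) = p ^ k))"

definition closed_subgroup_generated ::
  "('a, 'm) monoid_scheme \<Rightarrow> 'a topology \<Rightarrow> 'a set \<Rightarrow> 'a set" where
  "closed_subgroup_generated G T A = Abstract_Topology.closure_of T (generate G A)"

definition closed_normal_subgroup_generated ::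
  "('a, 'm) monoid_scheme \<Rightarrow> 'a topology \<Rightarrow> 'a set \<Rightarrow> 'a set" where
  "closed_normal_subgroup_generated G T A = \<Inter>{N. N \<lhd> G \<and> closedin T N \<and> A \<subseteq> N}"

definition quotient_topology :: "'a topology \<Rightarrow> ('a \<Rightarrow> 'b) \<Rightarrow> 'b topology" where
  "quotient_topology T q =
     topology (\<lambda>U. U \<subseteq> q ` topspace T \<and> openin T {t \<in> topspace T. q t \<in> U})"

lemma openin_quotient_topology:
  "openin (quotient_topology T q) U \<longleftrightarrow>
     U \<subseteq> q ` topspace T \<and> openin T {t \<in> topspace T. q t \<in> U}"
proof -
  have "istopology (\<lambda>U. U \<subseteq> q ` topspace T \<and> openin T {t \<in> topspace T. q t \<in> U})"
  proof -
    have 1: "{t \<in> topspace T. q t \<in> A \<inter> B} =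
        {t \<in> topspace T. q t \<in> A} \<inter> {t \<in> topspace T. q t \<in> B}" for A B
      by auto
    have 2: "{t \<in> topspace T. q t \<in> \<Union>K} = (\<Union>A\<in>K. {t \<in> topspace T. q t \<in> A})" for K
      by auto
    show ?thesis
      unfolding istopology_def 1 2 by (auto intro!: openin_Union)
  qed
  then show ?thesis
    by (simp add: quotient_topology_def)
qed

section \<open>Free pro-$p$ groups\<close>

definition converges_to_one ::
  "('a, 'm) monoid_scheme \<Rightarrow> 'a topology \<Rightarrow> ('i \<Rightarrow> 'a) \<Rightarrow> bool" where
  "converges_to_one G T x \<longleftrightarrow>
     range x \<subseteq> carrier G \<and> (\<forall>U. subgroup U G \<and> openin T U \<longrightarrow> finite {i. x i \<notin> U})"

text \<open>
  The universal property ranges over all pro-$p$ groups \<open>H\<close> whose elements have type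
  \<open>(nat + 'i) set\<close>. This is no restriction: a family indexed by \<open>'i\<close> and converging to 1 lies in the
  closed subgroup it generates, whose cardinality is at most \<open>2 ^ max \<aleph>\<^sub>0 |'i|\<close>, so that this
  subgroup has a copy with elements of that type.
\<close>

definition free_pro_p_group ::
  "nat \<Rightarrow> ('a, 'm) monoid_scheme \<Rightarrow> 'a topology \<Rightarrow> ('i \<Rightarrow> 'a) \<Rightarrow> bool" where
  "free_pro_p_group p S T x \<longleftrightarrow>
     pro_p_group p S T \<and> converges_to_one S T x \<and>
     closed_subgroup_generated S T (range x) = carrier S \<and>
     (\<forall>(H :: (nat + 'i) set monoid) TH y.
        pro_p_group p H TH \<and> converges_to_one H TH y \<longrightarrow>
        (\<exists>!\<phi>. \<phi> \<in> extensional (carrier S) \<and> \<phi> \<in> hom S H \<and> continuous_map T TH \<phi> \<and>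
              (\<forall>i. \<phi> (x i) = y i)))"

section \<open>The Zassenhaus filtration\<close>

definition commutator :: "('a, 'm) monoid_scheme \<Rightarrow> 'a \<Rightarrow> 'a \<Rightarrow> 'a" where
  "commutator G g h = inv\<^bsub>G\<^esub> g \<otimes>\<^bsub>G\<^esub> inv\<^bsub>G\<^esub> h \<otimes>\<^bsub>G\<^esub> g \<otimes>\<^bsub>G\<^esub> h"

text \<open>
  As usual for profinite groups, powers, commutators and products of subgroups are understood as
  closed subgroups. Here \<open>(m + p - 1) div p\<close> is the ceiling of \<open>m / p\<close>; the guard \<open>p \<le> 1\<close> only
  serves termination.
\<close>

function zassenhaus ::
  "nat \<Rightarrow> ('a, 'm) monoid_scheme \<Rightarrow> 'a topology \<Rightarrow> nat \<Rightarrow> 'a set" where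
  "zassenhaus p G T m =
     (if m \<le> 1 \<or> p \<le> 1 then carrier G
      else closed_subgroup_generated G T
        ((\<lambda>g. g [^]\<^bsub>G\<^esub> p) ` zassenhaus p G T ((m + p - 1) div p) \<union>
         (\<Union>a\<in>{1..<m}. (\<lambda>(g, h). commutator G g h) `
            (zassenhaus p G T a \<times> zassenhaus p G T (m - a)))))"
  by pat_completeness auto
termination
proof (relation "Wellfounded.measure (\<lambda>(p, G, T, m). m)", goal_cases)
  case (2 p G T m)
  then obtain m' p' where "m = m' + 2" "p = p' + 2"
    by (metis add.commute le_Suc_ex not_less_eq_eq numeral_2_eq_2 One_nat_def)
  then have "m + p - 1 < m * p"
    by (simp add: algebra_simps)
  then show ?case
    by (simp add: less_mult_imp_div_less)
qed auto

declare zassenhaus.simps [simp del]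

section \<open>Canonical decomposition modulo the fourth term\<close>

definition finite_ordered_prod ::
  "('a, 'm) monoid_scheme \<Rightarrow> 'k rel \<Rightarrow> ('k \<Rightarrow> 'a) \<Rightarrow> 'k set \<Rightarrow> 'a" where
  "finite_ordered_prod G L f F =
     foldr (\<lambda>k g. f k \<otimes>\<^bsub>G\<^esub> g)
       (THE ks. distinct ks \<and> set ks = F \<and> sorted_wrt (\<lambda>k l. (k, l) \<in> L) ks) \<one>\<^bsub>G\<^esub>"

text \<open>
  For an infinite index set the product is the limit of the ordered products over the finite
  subsets. It exists for every family that lies, up to finitely many members, in each open subgroup.
\<close>

definition has_ordered_prod ::
  "('a, 'm) monoid_scheme \<Rightarrow> 'a topology \<Rightarrow> 'k rel \<Rightarrow> ('k \<Rightarrow> 'a) \<Rightarrow> 'k set \<Rightarrow> 'a \<Rightarrow> bool" where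
  "has_ordered_prod G T L f A z \<longleftrightarrow>
     limitin T (finite_ordered_prod G L f) z (finite_subsets_at_top A)"

definition pair_indices :: "('i::wellorder \<times> 'i) set" where
  "pair_indices = {(i, j). i < j}"

definition triple_indices :: "('i::wellorder \<times> 'i \<times> 'i) set" where
  "triple_indices = {(i, j, k). i < j \<and> k \<le> j}"

text \<open>
  \<open>L2\<close> and \<open>L3\<close> are the orders in which the products over pairs and triples are taken. The values
  \<open>b i j\<close> and \<open>c i j k\<close> at other index tuples, and \<open>a\<close> for \<open>p > 3\<close>, carry no meaning.
\<close>

definition canonical_decomposition ::
  "nat \<Rightarrow> ('a, 'm) monoid_scheme \<Rightarrow> 'a topology \<Rightarrow> ('i::wellorder \<Rightarrow> 'a) \<Rightarrow>
   ('i \<times> 'i) rel \<Rightarrow> ('i \<times> 'i \<times> 'i) rel \<Rightarrow> 'a \<Rightarrow>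
   ('i \<Rightarrow> nat) \<Rightarrow> ('i \<Rightarrow> 'i \<Rightarrow> nat) \<Rightarrow> ('i \<Rightarrow> 'i \<Rightarrow> 'i \<Rightarrow> nat) \<Rightarrow> bool" where
  "canonical_decomposition p S T x L2 L3 r a b c \<longleftrightarrow>
     (\<forall>i. a i < p) \<and>
     (\<forall>(i, j) \<in> pair_indices. b i j < p) \<and>
     (\<forall>(i, j, k) \<in> triple_indices. c i j k < p) \<and>
     (\<exists>A B C r'.
        has_ordered_prod S T {(i, j). i \<le> j} (\<lambda>i. x i [^]\<^bsub>S\<^esub> (p * a i)) UNIV A \<and>
        has_ordered_prod S T L2
          (\<lambda>(i, j). commutator S (x i) (x j) [^]\<^bsub>S\<^esub> b i j) pair_indices B \<and>
        has_ordered_prod S T L3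
          (\<lambda>(i, j, k). commutator S (commutator S (x i) (x j)) (x k) [^]\<^bsub>S\<^esub> c i j k)
          triple_indices C \<and>
        r' \<in> zassenhaus p S T 4 \<and>
        r = (if p = 2 then A \<otimes>\<^bsub>S\<^esub> B \<otimes>\<^bsub>S\<^esub> C \<otimes>\<^bsub>S\<^esub> r'
             else if p = 3 then B \<otimes>\<^bsub>S\<^esub> A \<otimes>\<^bsub>S\<^esub> C \<otimes>\<^bsub>S\<^esub> r'
             else B \<otimes>\<^bsub>S\<^esub> C \<otimes>\<^bsub>S\<^esub> r'))"

definition u_coeff :: "('i::wellorder \<Rightarrow> 'i \<Rightarrow> nat) \<Rightarrow> 'i \<Rightarrow> 'i \<Rightarrow> nat" where
  "u_coeff b i j = (if i < j then b i j else b j i)"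

section \<open>Triple Massey products\<close>

text \<open>
  Inhomogeneous continuous cochains with values in the discrete trivial module \<open>\<bbbF>\<^sub>p\<close>, in the
  degrees that occur in triple Massey products of classes of degree one.
\<close>

abbreviation Fp :: "nat \<Rightarrow> int ring" where
  "Fp p \<equiv> residue_ring (int p)"

definition cochains1 :: "nat \<Rightarrow> ('g, 'm) monoid_scheme \<Rightarrow> 'g topology \<Rightarrow> ('g \<Rightarrow> int) set" where
  "cochains1 p G T =
     {f \<in> extensional (carrier G). continuous_map T (discrete_topology (carrier (Fp p))) f}"

definition coboundary1 ::
  "nat \<Rightarrow> ('g, 'm) monoid_scheme \<Rightarrow> ('g \<Rightarrow> int) \<Rightarrow> ('g \<times> 'g \<Rightarrow> int)" where
  "coboundary1 p G f =
     (\<lambda>(g, h) \<in> carrier G \<times> carrier G. f h \<ominus>\<^bsub>Fp p\<^esub> f (g \<otimes>\<^bsub>G\<^esub> h) \<oplus>\<^bsub>Fp p\<^esub> f g)"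

definition cup ::
  "nat \<Rightarrow> ('g, 'm) monoid_scheme \<Rightarrow> ('g \<Rightarrow> int) \<Rightarrow> ('g \<Rightarrow> int) \<Rightarrow> ('g \<times> 'g \<Rightarrow> int)" where
  "cup p G f f' = (\<lambda>(g, h) \<in> carrier G \<times> carrier G. f g \<otimes>\<^bsub>Fp p\<^esub> f' h)"

definition add_cochains2 ::
  "nat \<Rightarrow> ('g, 'm) monoid_scheme \<Rightarrow> ('g \<times> 'g \<Rightarrow> int) \<Rightarrow> ('g \<times> 'g \<Rightarrow> int) \<Rightarrow> ('g \<times> 'g \<Rightarrow> int)" where
  "add_cochains2 p G z z' = (\<lambda>t \<in> carrier G \<times> carrier G. z t \<oplus>\<^bsub>Fp p\<^esub> z' t)"

definition zero_cochain2 :: "nat \<Rightarrow> ('g, 'm) monoid_scheme \<Rightarrow> ('g \<times> 'g \<Rightarrow> int)" where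
  "zero_cochain2 p G = (\<lambda>t \<in> carrier G \<times> carrier G. \<zero>\<^bsub>Fp p\<^esub>)"

text \<open>
  The action is trivial, so the coboundary from degree 0 to degree 1 vanishes: a class in \<open>H\<^sup>1\<close> is a
  1-cocycle and is its own only representative. A class in \<open>H\<^sup>2\<close> is a coset of the 2-coboundaries.
\<close>

definition H1 :: "nat \<Rightarrow> ('g, 'm) monoid_scheme \<Rightarrow> 'g topology \<Rightarrow> ('g \<Rightarrow> int) set" where
  "H1 p G T = {f \<in> cochains1 p G T. coboundary1 p G f = zero_cochain2 p G}"

definition class2 ::
  "nat \<Rightarrow> ('g, 'm) monoid_scheme \<Rightarrow> 'g topology \<Rightarrow> ('g \<times> 'g \<Rightarrow> int) \<Rightarrow> ('g \<times> 'g \<Rightarrow> int) set" where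
  "class2 p G T z = {add_cochains2 p G z (coboundary1 p G f) | f. f \<in> cochains1 p G T}"

definition defining_system ::
  "nat \<Rightarrow> ('g, 'm) monoid_scheme \<Rightarrow> 'g topology \<Rightarrow>
   ('g \<Rightarrow> int) \<Rightarrow> ('g \<Rightarrow> int) \<Rightarrow> ('g \<Rightarrow> int) \<Rightarrow> (nat \<Rightarrow> nat \<Rightarrow> 'g \<Rightarrow> int) \<Rightarrow> bool" where
  "defining_system p G T \<alpha>1 \<alpha>2 \<alpha>3 a \<longleftrightarrow>
     a 1 2 = \<alpha>1 \<and> a 2 3 = \<alpha>2 \<and> a 3 4 = \<alpha>3 \<and>
     a 1 3 \<in> cochains1 p G T \<and> a 2 4 \<in> cochains1 p G T \<and>
     coboundary1 p G (a 1 3) = cup p G (a 1 2) (a 2 3) \<and>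
     coboundary1 p G (a 2 4) = cup p G (a 2 3) (a 3 4)"

definition triple_massey_product ::
  "nat \<Rightarrow> ('g, 'm) monoid_scheme \<Rightarrow> 'g topology \<Rightarrow>
   ('g \<Rightarrow> int) \<Rightarrow> ('g \<Rightarrow> int) \<Rightarrow> ('g \<Rightarrow> int) \<Rightarrow> ('g \<times> 'g \<Rightarrow> int) set set" where
  "triple_massey_product p G T \<alpha>1 \<alpha>2 \<alpha>3 =
     {class2 p G T (add_cochains2 p G (cup p G (a 1 2) (a 2 4)) (cup p G (a 1 3) (a 3 4))) | a.
        defining_system p G T \<alpha>1 \<alpha>2 \<alpha>3 a}"

definition vanishing_triple_massey ::
  "nat \<Rightarrow> ('g, 'm) monoid_scheme \<Rightarrow> 'g topology \<Rightarrow> bool" where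
  "vanishing_triple_massey p G T \<longleftrightarrow>
     (\<forall>\<alpha>1 \<in> H1 p G T. \<forall>\<alpha>2 \<in> H1 p G T. \<forall>\<alpha>3 \<in> H1 p G T.
        triple_massey_product p G T \<alpha>1 \<alpha>2 \<alpha>3 \<noteq> {} \<longrightarrow>
        class2 p G T (zero_cochain2 p G) \<in> triple_massey_product p G T \<alpha>1 \<alpha>2 \<alpha>3)"

end

theory Submission
  imports Defs
begin

text \<open>
  A continuous homomorphism from a group to the unitriangular group \<open>U\<^sub>4(\<bbbF>\<^sub>p)\<close> modulo its centre is
  the same as a defining system of a triple Massey product (up to the sign of the entries), and the
  product contains \<open>0\<close> iff some such homomorphism with the same superdiagonal lifts to \<open>U\<^sub>4(\<bbbF>\<^sub>p)\<close>.
  Let \<open>{m, n} = {i, j}\<close> and consider homomorphisms that send \<open>x\<^sub>m\<close> to a matrix with superdiagonal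
  \<open>(1, 1, 0)\<close>, \<open>x\<^sub>n\<close> to one with superdiagonal \<open>(0, 0, 1)\<close>, and the other generators to matrices with
  superdiagonal \<open>0\<close>. The simplest one maps all relators into the centre, so the Massey product
  \<open>\<langle>\<chi>\<^sub>m, \<chi>\<^sub>m, \<chi>\<^sub>n\<rangle>\<close> is defined. Every one of them kills \<open>S\<^sub>(\<^sub>4\<^sub>)\<close> and all factors of \<open>r\<close> except
  \<open>[[x\<^sub>i, x\<^sub>j], x\<^sub>m]\<close>, whose image is the elementary matrix with entry \<open>\<plusminus>1\<close> in the corner; hence none of
  them kills \<open>r\<close>, and the Massey product does not contain \<open>0\<close>.
\<close>

section \<open>Unitriangular matrices\<close>

type_synonym ut4 = "int \<times> int \<times> int \<times> int \<times> int \<times> int"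

text \<open>
  A unitriangular \<open>4 \<times> 4\<close> matrix is stored as the tuple of its entries
  \<open>(1,2), (2,3), (3,4), (1,3), (2,4), (1,4)\<close>.
\<close>

fun ut4_mult :: "ut4 \<Rightarrow> ut4 \<Rightarrow> ut4" where
  "ut4_mult (a, b, c, d, e, f) (a', b', c', d', e', f') =
     (a + a', b + b', c + c', d + d' + a * b', e + e' + b * c', f + f' + a * e' + d * c')"

fun ut4_inv :: "ut4 \<Rightarrow> ut4" where
  "ut4_inv (a, b, c, d, e, f) = (- a, - b, - c, a * b - d, b * c - e, a * e + d * c - a * b * c - f)"

fun ut4_mod :: "nat \<Rightarrow> ut4 \<Rightarrow> ut4" where
  "ut4_mod p (a, b, c, d, e, f) =
     (a mod int p, b mod int p, c mod int p, d mod int p, e mod int p, f mod int p)"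

text \<open>Entries are reduced representatives, and the product reduces once after integer matrix
  multiplication. The group laws thus become polynomial identities over the integers.\<close>

definition UT4 :: "nat \<Rightarrow> ut4 monoid" where
  "UT4 p = \<lparr>carrier = {0..<int p} \<times> {0..<int p} \<times> {0..<int p} \<times> {0..<int p} \<times> {0..<int p} \<times> {0..<int p},
     mult = (\<lambda>x y. ut4_mod p (ut4_mult x y)), one = (0, 0, 0, 0, 0, 0)\<rparr>"

lemma ut4_mod_mult_left: "ut4_mod p (ut4_mult (ut4_mod p x) y) = ut4_mod p (ut4_mult x y)"
  by (cases x; cases y)
    (auto simp flip: cong_def intro!: cong_add cong_mult)

lemma ut4_mod_mult_right: "ut4_mod p (ut4_mult x (ut4_mod p y)) = ut4_mod p (ut4_mult x y)"
  by (cases x; cases y)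
    (auto simp flip: cong_def intro!: cong_add cong_mult)

lemma ut4_mult_assoc: "ut4_mult (ut4_mult x y) z = ut4_mult x (ut4_mult y z)"
  by (cases x; cases y; cases z) (simp add: algebra_simps)

lemma ut4_mult_inv_left: "ut4_mult (ut4_inv x) x = (0, 0, 0, 0, 0, 0)"
  by (cases x) (simp add: algebra_simps)

lemma UT4_one: "\<one>\<^bsub>UT4 p\<^esub> = (0, 0, 0, 0, 0, 0)"
  by (simp add: UT4_def)

lemma UT4_mult: "x \<otimes>\<^bsub>UT4 p\<^esub> y = ut4_mod p (ut4_mult x y)"
  by (simp add: UT4_def)

lemma UT4_carrier:
  "(a, b, c, d, e, f) \<in> carrier (UT4 p) \<longleftrightarrow> {a, b, c, d, e, f} \<subseteq> {0..<int p}"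
  by (simp add: UT4_def)

lemma ut4_mod_carrier: "p > 0 \<Longrightarrow> ut4_mod p x \<in> carrier (UT4 p)"
  by (cases x) (simp add: UT4_carrier)

lemma ut4_mod_id: "x \<in> carrier (UT4 p) \<Longrightarrow> ut4_mod p x = x"
  by (cases x) (simp add: UT4_carrier)

lemma finite_UT4: "finite (carrier (UT4 p))"
  by (simp add: UT4_def)

lemma order_UT4: "order (UT4 p) = p ^ 6"
  by (simp add: order_def UT4_def card_cartesian_product eval_nat_numeral)

lemma UT4_mult_inv_left: "ut4_mod p (ut4_inv x) \<otimes>\<^bsub>UT4 p\<^esub> x = \<one>\<^bsub>UT4 p\<^esub>"
  by (simp add: UT4_mult ut4_mod_mult_left ut4_mult_inv_left UT4_one)

lemma group_UT4:
  assumes "p > 0"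
  shows "group (UT4 p)"
proof (rule groupI)
  show "x \<otimes>\<^bsub>UT4 p\<^esub> y \<in> carrier (UT4 p)" for x y
    using assms by (simp add: UT4_mult ut4_mod_carrier)
  show "\<one>\<^bsub>UT4 p\<^esub> \<in> carrier (UT4 p)"
    using assms by (simp add: UT4_one UT4_carrier)
  show "x \<otimes>\<^bsub>UT4 p\<^esub> y \<otimes>\<^bsub>UT4 p\<^esub> z = x \<otimes>\<^bsub>UT4 p\<^esub> (y \<otimes>\<^bsub>UT4 p\<^esub> z)" for x y z
    by (simp add: UT4_mult ut4_mod_mult_left ut4_mod_mult_right ut4_mult_assoc)
  show "\<one>\<^bsub>UT4 p\<^esub> \<otimes>\<^bsub>UT4 p\<^esub> x = x" if "x \<in> carrier (UT4 p)" for x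
    using ut4_mod_id[OF that] by (cases x) (simp add: UT4_mult UT4_one)
  show "\<exists>y\<in>carrier (UT4 p). y \<otimes>\<^bsub>UT4 p\<^esub> x = \<one>\<^bsub>UT4 p\<^esub>" for x
    using UT4_mult_inv_left ut4_mod_carrier assms by blast
qed

lemma UT4_inv:
  assumes "p > 0" "x \<in> carrier (UT4 p)"
  shows "inv\<^bsub>UT4 p\<^esub> x = ut4_mod p (ut4_inv x)"
  using assms by (intro group.inv_equality group_UT4 UT4_mult_inv_left ut4_mod_carrier)

text \<open>Write the matrix as 1 + N with N strictly upper triangular. Since N^4 = 0, the binomial
  expansion of (1 + N)^n stops at N^3, whose only entry is a*b*c in the corner.\<close>

lemma UT4_pow:
  fixes n :: nat
  shows "(a, b, c, d, e, f) [^]\<^bsub>UT4 p\<^esub> n = ut4_mod p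
    (int n * a, int n * b, int n * c,
     int n * d + int (n choose 2) * (a * b), int n * e + int (n choose 2) * (b * c),
     int n * f + int (n choose 2) * (a * e + d * c) + int (n choose 3) * (a * b * c))"
proof (induction n)
  case 0
  then show ?case by (simp add: UT4_one numeral_eq_Suc)
next
  case (Suc n)
  have "Suc n choose 2 = n + (n choose 2)" "Suc n choose 3 = (n choose 2) + (n choose 3)"
    by (simp_all add: numeral_eq_Suc)
  then show ?case
    by (simp add: Suc.IH UT4_mult ut4_mod_mult_left del: ut4_mod.simps) (simp add: algebra_simps)
qed

text \<open>For x = 1 + N and y = 1 + M one has [x, y] = 1 + (yx)^(-1) (NM - MN). The left factor
  changes only the corner of NM - MN, through its (1,2) entry -(a + a').\<close>

lemma UT4_commutator:
  assumes "p > 0"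
    and "(a, b, c, d, e, f) \<in> carrier (UT4 p)" "(a', b', c', d', e', f') \<in> carrier (UT4 p)"
  shows "commutator (UT4 p) (a, b, c, d, e, f) (a', b', c', d', e', f') = ut4_mod p
    (0, 0, 0, a * b' - a' * b, b * c' - b' * c,
     a * e' - a' * e + d * c' - d' * c - (a + a') * (b * c' - b' * c))"
  using assms
  by (simp add: commutator_def UT4_inv UT4_mult ut4_mod_mult_left ut4_mod_mult_right
      del: ut4_mod.simps) (simp add: algebra_simps)

text \<open>The inner commutator has zero superdiagonal, so in the outer one only its (1,3) and
  (2,4) entries, paired with c'' and a'', contribute.\<close>

lemma UT4_commutator_commutator:
  assumes "p > 0"
    and "(a, b, c, d, e, f) \<in> carrier (UT4 p)" "(a', b', c', d', e', f') \<in> carrier (UT4 p)"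
    and "(a'', b'', c'', d'', e'', f'') \<in> carrier (UT4 p)"
  shows "commutator (UT4 p) (commutator (UT4 p) (a, b, c, d, e, f) (a', b', c', d', e', f'))
      (a'', b'', c'', d'', e'', f'') = ut4_mod p
    (0, 0, 0, 0, 0, (a * b' - a' * b) * c'' - a'' * (b * c' - b' * c))"
proof -
  have "[(x mod int p) * c'' - a'' * (y mod int p) = x * c'' - a'' * y] (mod int p)" for x y
    by (intro cong_diff cong_mult) simp_all
  then show ?thesis
    unfolding UT4_commutator[OF assms(1,2,3)] ut4_mod.simps
    by (subst UT4_commutator) (use assms in \<open>auto simp: UT4_carrier cong_def\<close>)
qed

section \<open>The filtration of the unitriangular group by diagonals\<close>

text \<open>In level l the first l - 1 diagonals above the main one vanish: level 3 is the central
  corner subgroup, and all levels from 4 on are trivial. Allowing every natural l spares a cap on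
  sums and products of levels.\<close>

definition UT4_level :: "nat \<Rightarrow> nat \<Rightarrow> ut4 set" where
  "UT4_level p l = {(a, b, c, d, e, f). (a, b, c, d, e, f) \<in> carrier (UT4 p) \<and>
     (2 \<le> l \<longrightarrow> a = 0 \<and> b = 0 \<and> c = 0) \<and> (3 \<le> l \<longrightarrow> d = 0 \<and> e = 0) \<and> (4 \<le> l \<longrightarrow> f = 0)}"

lemma subgroup_UT4_level:
  assumes "p > 0"
  shows "subgroup (UT4_level p l) (UT4 p)"
proof
  show "UT4_level p l \<subseteq> carrier (UT4 p)"
    by (auto simp: UT4_level_def)
  show "\<one>\<^bsub>UT4 p\<^esub> \<in> UT4_level p l"
    using assms by (simp add: UT4_level_def UT4_one UT4_carrier)
  show "x \<otimes>\<^bsub>UT4 p\<^esub> y \<in> UT4_level p l" if "x \<in> UT4_level p l" "y \<in> UT4_level p l" for x y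
    using that assms by (cases x; cases y) (auto simp: UT4_level_def UT4_mult UT4_carrier)
  show "inv\<^bsub>UT4 p\<^esub> x \<in> UT4_level p l" if "x \<in> UT4_level p l" for x
  proof -
    have "x \<in> carrier (UT4 p)"
      using that by (auto simp: UT4_level_def)
    then show ?thesis
      using that assms by (cases x) (auto simp: UT4_level_def UT4_inv UT4_carrier)
  qed
qed

text \<open>If N and M start on the k-th and l-th diagonal, then NM - MN starts on the (k +
  l)-th.\<close>

lemma UT4_level_commutator:
  assumes "p > 0" "x \<in> UT4_level p k" "y \<in> UT4_level p l" "k > 0" "l > 0"
  shows "commutator (UT4 p) x y \<in> UT4_level p (k + l)"
proof (cases x)
  case x: (fields a b c d e f)
  show ?thesis
  proof (cases y)
    case y: (fields a' b' c' d' e' f')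
    have *: "commutator (UT4 p) x y = ut4_mod p
      (0, 0, 0, a * b' - a' * b, b * c' - b' * c,
       a * e' - a' * e + d * c' - d' * c - (a + a') * (b * c' - b' * c))"
      using assms unfolding x y by (intro UT4_commutator) (auto simp: UT4_level_def)
    show ?thesis
      unfolding * using assms unfolding x y UT4_level_def UT4_carrier
      by (cases "2 \<le> k"; cases "2 \<le> l"; cases "3 \<le> k"; cases "3 \<le> l") auto
  qed
qed

text \<open>In the expansion of (1 + N)^p the inner binomial coefficients vanish modulo p, which
  leaves 1 + N^p, and N^p starts on the diagonal p * l.\<close>

lemma UT4_level_pow_prime:
  assumes "prime p" "x \<in> UT4_level p l" "l > 0"
  shows "x [^]\<^bsub>UT4 p\<^esub> p \<in> UT4_level p (p * l)"
proof (cases x)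
  case (fields a b c d e f)
  have p: "p > 1" using assms(1) prime_gt_1_nat by blast
  have dvd: "int p dvd int (p choose k)" if "0 < k" "k < p" for k
    using dvd_choose_prime[of k p] assms that by simp
  \<comment> \<open>For l at least 2 the target level is trivial and N^2 = 0. For l = 1 the last
    term N^p is visible only for p = 2 and p = 3.\<close>
  consider "l \<ge> 2" | "l = 1" "p = 2" | "l = 1" "p = 3" | "l = 1" "p > 3"
    using p \<open>l > 0\<close> by linarith
  then show ?thesis
  proof cases
    case 1
    then have "a = 0" "b = 0" "c = 0" "3 \<le> l \<Longrightarrow> d = 0 \<and> e = 0" "4 \<le> l \<Longrightarrow> f = 0"
      using assms(2) by (auto simp: UT4_level_def fields)
    then show ?thesis
      using p unfolding fields UT4_pow by (simp add: UT4_level_def UT4_carrier)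
  next
    case 2
    then show ?thesis
      unfolding fields UT4_pow by (simp add: UT4_level_def UT4_carrier)
  next
    case 3
    then show ?thesis
      using dvd[of 2] unfolding fields UT4_pow by (simp add: UT4_level_def UT4_carrier mod_eq_0_iff_dvd)
  next
    case 4
    then show ?thesis
      using dvd[of 2] dvd[of 3] unfolding fields UT4_pow
      by (simp add: UT4_level_def UT4_carrier mod_eq_0_iff_dvd)
  qed
qed

section \<open>Continuous homomorphisms to discrete groups\<close>

text \<open>This gives meaning to the description operator in \<open>finite_ordered_prod\<close>.
  Existence is by insertion, uniqueness by comparing heads.\<close>

lemma ex1_sorted_list_of_linear_order:
  assumes L: "linear_order_on A L" and "finite F" "F \<subseteq> A"
  shows "\<exists>!ks. distinct ks \<and> set ks = F \<and> sorted_wrt (\<lambda>k l. (k, l) \<in> L) ks"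
proof (rule ex_ex1I)
  have trans: "trans L" and antisym: "antisym L" and total: "total_on A L"
    using L by (auto simp: order_on_defs)
  show "\<exists>ks. distinct ks \<and> set ks = F \<and> sorted_wrt (\<lambda>k l. (k, l) \<in> L) ks"
    using assms(2,3)
  proof (induction F rule: finite_induct)
    case empty
    then show ?case by simp
  next
    case (insert y F)
    then obtain ks where ks: "distinct ks" "set ks = F" "sorted_wrt (\<lambda>k l. (k, l) \<in> L) ks"
      by auto
    \<comment> \<open>Filtering keeps \<open>ks\<close> sorted, and transitivity through y orders
      the first part before the second.\<close>
    let ?ks = "filter (\<lambda>k. (k, y) \<in> L) ks @ y # filter (\<lambda>k. (k, y) \<notin> L) ks"
    have above: "(y, l) \<in> L" if "l \<in> F" "(l, y) \<notin> L" for l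
    proof -
      have "l \<in> A" "y \<in> A" "l \<noteq> y"
        using that insert.hyps insert.prems by auto
      then show ?thesis
        using total that(2) unfolding total_on_def by blast
    qed
    have "distinct ?ks" "set ?ks = insert y F"
      using ks insert.hyps by auto
    moreover have "sorted_wrt (\<lambda>k l. (k, l) \<in> L) ?ks"
      using ks above transD[OF trans] by (auto simp: sorted_wrt_append sorted_wrt_filter)
    ultimately show ?case by blast
  qed
  show "ks = ls"
    if "distinct ks \<and> set ks = F \<and> sorted_wrt (\<lambda>k l. (k, l) \<in> L) ks"
      and "distinct ls \<and> set ls = F \<and> sorted_wrt (\<lambda>k l. (k, l) \<in> L) ls" for ks ls
    using that
  proof (induction ks arbitrary: ls F)
    case Nil
    then show ?case by simp
  next
    case (Cons k ks)
    obtain l ls' where ls: "ls = l # ls'"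
      using Cons.prems by (cases ls) auto
    \<comment> \<open>Otherwise each head occurs in the tail of the other list, and sortedness puts
      both (k, l) and (l, k) into L.\<close>
    have "k = l"
    proof (rule ccontr)
      assume "k \<noteq> l"
      then have "k \<in> set ls'" "l \<in> set ks"
        using Cons.prems ls by auto
      then have "(l, k) \<in> L" "(k, l) \<in> L"
        using Cons.prems ls by auto
      then show False
        using antisymD[OF antisym] \<open>k \<noteq> l\<close> by blast
    qed
    moreover have "ks = ls'"
      using Cons.prems by (intro Cons.IH[of "set ks"]) (auto simp: ls \<open>k = l\<close>)
    ultimately show ?case
      by (simp add: ls)
  qed
qed

lemma finite_ordered_prod_foldr:
  assumes "linear_order_on A L" "finite F" "F \<subseteq> A"
  obtains ks where "distinct ks" "set ks = F"
    and "finite_ordered_prod G L f F = foldr (\<lambda>k g. f k \<otimes>\<^bsub>G\<^esub> g) ks \<one>\<^bsub>G\<^esub>"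
proof -
  let ?P = "\<lambda>ks. distinct ks \<and> set ks = F \<and> sorted_wrt (\<lambda>k l. (k, l) \<in> L) ks"
  have "?P (THE ks. ?P ks)"
    by (rule theI') (rule ex1_sorted_list_of_linear_order[OF assms])
  then show ?thesis
    using that[of "THE ks. ?P ks"] by (simp add: finite_ordered_prod_def)
qed

lemma (in group) commutator_closed [simp]:
  "x \<in> carrier G \<Longrightarrow> y \<in> carrier G \<Longrightarrow> commutator G x y \<in> carrier G"
  by (simp add: commutator_def)

lemma (in group_hom) hom_commutator:
  "x \<in> carrier G \<Longrightarrow> y \<in> carrier G \<Longrightarrow> h (commutator G x y) = commutator H (h x) (h y)"
  by (simp add: commutator_def)

lemma (in group_hom) subgroup_vimage:
  assumes "subgroup K H"
  shows "subgroup {g \<in> carrier G. h g \<in> K} G"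
proof -
  interpret K: subgroup K H by fact
  show ?thesis
    by unfold_locales auto
qed

lemma (in group_hom) normal_vimage:
  assumes "K \<lhd> H"
  shows "{g \<in> carrier G. h g \<in> K} \<lhd> G"
proof -
  interpret K: normal K H by fact
  show ?thesis
    unfolding G.normal_inv_iff
    by (auto intro!: subgroup_vimage K.subgroup_axioms K.inv_op_closed2)
qed

section \<open>Discrete images of closed subgroups and of infinite products\<close>

locale discrete_hom = group_hom G H h for G (structure) and H (structure) and h +
  fixes T :: "'a topology"
  assumes topspace_eq: "topspace T = carrier G"
    and cont: "continuous_map T (discrete_topology (carrier H)) h"
begin

lemma openin_vimage: "openin T {g \<in> carrier G. h g \<in> A}"
proof -
  have "openin T {g \<in> topspace T. h g \<in> A \<inter> carrier H}"
    by (intro openin_continuous_map_preimage[OF cont]) simp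
  moreover have "{g \<in> topspace T. h g \<in> A \<inter> carrier H} = {g \<in> carrier G. h g \<in> A}"
    by (auto simp: topspace_eq)
  ultimately show ?thesis by simp
qed

lemma closedin_vimage: "closedin T {g \<in> carrier G. h g \<in> A}"
proof -
  have "topspace T - {g \<in> carrier G. h g \<in> A} = {g \<in> carrier G. h g \<in> - A}"
    by (auto simp: topspace_eq)
  then show ?thesis
    using openin_vimage[of "- A"] by (auto simp: closedin_def topspace_eq)
qed

text \<open>The preimage of K is a subgroup and is closed, so it absorbs the closure of the
  generated subgroup.\<close>

lemma closed_subgroup_generated_image:
  assumes "subgroup K H" "A \<subseteq> carrier G" "h ` A \<subseteq> K"
  shows "h ` closed_subgroup_generated G T A \<subseteq> K"
proof -
  have "generate G A \<subseteq> {g \<in> carrier G. h g \<in> K}"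
    using assms by (intro G.generate_subgroup_incl subgroup_vimage) auto
  then have "closed_subgroup_generated G T A \<subseteq> {g \<in> carrier G. h g \<in> K}"
    unfolding closed_subgroup_generated_def by (rule closure_of_minimal) (rule closedin_vimage)
  then show ?thesis by auto
qed

lemma closed_normal_subgroup_generated_image:
  assumes "K \<lhd> H" "A \<subseteq> carrier G" "h ` A \<subseteq> K"
  shows "h ` closed_normal_subgroup_generated G T A \<subseteq> K"
proof -
  have "closed_normal_subgroup_generated G T A \<subseteq> {g \<in> carrier G. h g \<in> K}"
    unfolding closed_normal_subgroup_generated_def
    using assms normal_vimage[OF assms(1)] closedin_vimage[of K] by (intro Inter_lower) auto
  then show ?thesis by auto
qed

text \<open>The fibre of h through z is an open neighbourhood of z, so all sufficiently large finite
  subproducts have image h z. In such a product only the factor at k is visible to h.\<close>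

lemma has_ordered_prod_image:
  assumes prod: "has_ordered_prod G T L f A z" and L: "linear_order_on A L"
    and f: "f ` A \<subseteq> carrier G" and k: "k \<in> A"
    and trivial: "\<And>l. l \<in> A \<Longrightarrow> l \<noteq> k \<Longrightarrow> h (f l) = \<one>\<^bsub>H\<^esub>"
  shows "h z = h (f k)" "z \<in> carrier G"
proof -
  show z: "z \<in> carrier G"
    using limitin_topspace[OF prod[unfolded has_ordered_prod_def]] topspace_eq by simp
  have "eventually (\<lambda>F. finite_ordered_prod G L f F \<in> {g \<in> carrier G. h g \<in> {h z}})
      (finite_subsets_at_top A)"
    by (rule limitinD[OF prod[unfolded has_ordered_prod_def] openin_vimage]) (simp add: z)
  then obtain F where F: "finite F" "F \<subseteq> A"
    and eq: "\<forall>F'. finite F' \<and> F \<subseteq> F' \<and> F' \<subseteq> A \<longrightarrow>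
      finite_ordered_prod G L f F' \<in> {g \<in> carrier G. h g \<in> {h z}}"
    unfolding eventually_finite_subsets_at_top by (elim exE conjE)
  \<comment> \<open>Adjoining k guarantees that the factor f k occurs.\<close>
  have kF: "finite (insert k F)" "insert k F \<subseteq> A"
    using F k by auto
  obtain ks where ks: "distinct ks" "set ks = insert k F"
    and fold: "finite_ordered_prod G L f (insert k F) = foldr (\<lambda>k g. f k \<otimes> g) ks \<one>"
    by (rule finite_ordered_prod_foldr[OF L kF])
  \<comment> \<open>Membership in the carrier is carried along the induction because
    multiplicativity of h requires it.\<close>
  have "foldr (\<lambda>k g. f k \<otimes> g) ls \<one> \<in> carrier G \<and>
      h (foldr (\<lambda>k g. f k \<otimes> g) ls \<one>) = (if k \<in> set ls then h (f k) else \<one>\<^bsub>H\<^esub>)"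
    if "distinct ls" "set ls \<subseteq> A" for ls
    using that
  proof (induction ls)
    case Nil
    then show ?case by simp
  next
    case (Cons l ls)
    then have "f l \<in> carrier G" "f k \<in> carrier G"
      using f k by auto
    then show ?case
      using Cons trivial[of l] by (cases "l = k") auto
  qed
  from this[of ks] show "h z = h (f k)"
    using eq[rule_format, of "insert k F"] subset_insertI[of F k] fold ks kF by auto
qed

end

section \<open>The Zassenhaus filtration maps into the levels\<close>

lemma zassenhaus_subset_carrier:
  assumes "topspace T = carrier G"
  shows "zassenhaus p G T m \<subseteq> carrier G"
proof -
  have "T closure_of A \<subseteq> carrier G" for A
    using closure_of_subset_topspace[of T A] assms by simp
  then show ?thesis
    by (subst zassenhaus.simps) (simp add: closed_subgroup_generated_def)
qed

text \<open>The levels satisfy the power and commutator rules that generate the Zassenhaus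
  filtration, so induction along its recursion applies.\<close>

lemma zassenhaus_UT4_level:
  fixes G (structure)
  assumes "discrete_hom G (UT4 p) h T" "prime p"
  shows "h ` zassenhaus p G T m \<subseteq> UT4_level p m"
proof (induction m rule: less_induct)
  case (less m)
  interpret discrete_hom G "UT4 p" h T by fact
  have p: "p > 1" using assms(2) prime_gt_1_nat by blast
  show ?case
  proof (cases "m \<le> 1")
    case True
    have "h g \<in> UT4_level p m" if "g \<in> carrier G" for g
      using hom_closed[OF that] True by (cases "h g") (auto simp: UT4_level_def)
    moreover have "zassenhaus p G T m = carrier G"
      using True by (subst zassenhaus.simps) simp
    ultimately show ?thesis by auto
  next
    case False
    let ?l = "(m + p - 1) div p"
    let ?Z = "zassenhaus p G T"
    have sub: "?Z k \<subseteq> carrier G" for k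
      by (intro zassenhaus_subset_carrier topspace_eq)
    have IH: "h g \<in> UT4_level p k" if "g \<in> ?Z k" "k < m" for g k
      using less that by blast
    \<comment> \<open>This makes the ceiling of m / p smaller than m, so the induction hypothesis
      covers the p-th powers.\<close>
    have "m + p - 1 < m * p"
    proof -
      have "2 \<le> m" "2 \<le> p" using False p by auto
      then obtain m' p' where "m = 2 + m'" "p = 2 + p'"
        using le_Suc_ex by blast
      then show ?thesis by (simp add: algebra_simps)
    qed
    then have l: "?l < m"
      by (simp add: less_mult_imp_div_less)
    have l0: "?l > 0"
      using False p by (simp add: div_greater_zero_iff)
    \<comment> \<open>Rounding up gives m <= p * ceiling(m / p), so p-th powers land at least as
      deep as level m.\<close>
    have pl: "m \<le> p * ?l"
      using mult_div_mod_eq[of p "m + p - 1"] mod_less_divisor[of p "m + p - 1"] p by linarith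
    have mono: "UT4_level p k \<subseteq> UT4_level p m" if "m \<le> k" for k
      using that by (auto simp: UT4_level_def)
    have pow: "h (g [^] p) \<in> UT4_level p m" if "g \<in> ?Z ?l" for g
      using UT4_level_pow_prime[OF assms(2) IH[OF that l] l0] mono[OF pl] subsetD[OF sub that]
      by (auto simp: hom_nat_pow)
    have comm: "h (commutator G g g') \<in> UT4_level p m"
      if "k \<in> {1..<m}" "g \<in> ?Z k" "g' \<in> ?Z (m - k)" for k g g'
    proof -
      have "commutator (UT4 p) (h g) (h g') \<in> UT4_level p (k + (m - k))"
        using that p by (intro UT4_level_commutator IH) auto
      moreover have "g \<in> carrier G" "g' \<in> carrier G"
        using that sub by blast+
      ultimately show ?thesis
        using that by (simp add: hom_commutator)
    qed
    have Z: "?Z m = closed_subgroup_generated G T ((\<lambda>g. g [^] p) ` ?Z ?l \<union>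
         (\<Union>k\<in>{1..<m}. (\<lambda>(g, h). commutator G g h) ` (?Z k \<times> ?Z (m - k))))"
      using False p by (subst zassenhaus.simps) simp
    show ?thesis
      unfolding Z
    proof (rule closed_subgroup_generated_image)
      show "subgroup (UT4_level p m) (UT4 p)"
        using p by (simp add: subgroup_UT4_level)
      show "(\<lambda>g. g [^] p) ` ?Z ?l \<union>
         (\<Union>k\<in>{1..<m}. (\<lambda>(g, h). commutator G g h) ` (?Z k \<times> ?Z (m - k))) \<subseteq> carrier G"
        using sub by (auto intro!: G.commutator_closed G.nat_pow_closed)
      show "h ` ((\<lambda>g. g [^] p) ` ?Z ?l \<union>
         (\<Union>k\<in>{1..<m}. (\<lambda>(g, h). commutator G g h) ` (?Z k \<times> ?Z (m - k)))) \<subseteq> UT4_level p m"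
        using pow comm by auto
    qed
  qed
qed

section \<open>Finite p-groups as targets of the universal property\<close>

lemma pro_p_group_discrete:
  assumes "prime p" "group H" "finite (carrier H)" "order H = p ^ k"
  shows "pro_p_group p H (discrete_topology (carrier H))"
proof -
  interpret group H by fact
  have "continuous_map (prod_topology (discrete_topology (carrier H)) (discrete_topology (carrier H)))
      (discrete_topology (carrier H)) (\<lambda>(g, h). g \<otimes>\<^bsub>H\<^esub> h)"
    unfolding prod_topology_discrete_topology[symmetric] by auto
  then have "topological_group H (discrete_topology (carrier H))"
    unfolding topological_group_def using assms(2) by auto
  moreover have "compact_space (discrete_topology (carrier H))"
    using assms(3) by (simp add: compact_space_discrete_topology)
  moreover have "Hausdorff_space (discrete_topology (carrier H))"
    by (simp add: Hausdorff_space_discrete_topology)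
  moreover have "\<exists>l. card (rcosets\<^bsub>H\<^esub> N) = p ^ l" if "N \<lhd> H" for N
  proof -
    have "card (rcosets\<^bsub>H\<^esub> N) * card N = p ^ k"
      using lagrange[of N] that assms(4) by (simp add: normal_def)
    then have "card (rcosets\<^bsub>H\<^esub> N) dvd p ^ k"
      by (metis dvd_triv_left)
    then show ?thesis
      using divides_primepow_nat[OF assms(1)] by blast
  qed
  ultimately show ?thesis
    unfolding pro_p_group_def profinite_group_def
    by (auto simp: connectedin_discrete_topology)
qed

lemma free_pro_p_group_group:
  assumes "free_pro_p_group p S T x"
  shows "group S" "topspace T = carrier S" "range x \<subseteq> carrier S"
proof -
  have "pro_p_group p S T" "converges_to_one S T x"
    using assms by (simp_all add: free_pro_p_group_def)
  then show "group S" "topspace T = carrier S" "range x \<subseteq> carrier S"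
    by (simp_all add: pro_p_group_def profinite_group_def topological_group_def converges_to_one_def)
qed

text \<open>The universal property speaks only of groups with elements of type
  \<open>(nat + 'i) set\<close>. A finite p-group on a countable type is copied there through
  singletons, and the homomorphism obtained is carried back by \<open>dec\<close>.\<close>

lemma free_pro_p_group_obtain_hom:
  fixes H :: "'u::countable monoid" and x :: "'i \<Rightarrow> 'a" and y :: "'i \<Rightarrow> 'u"
  assumes free: "free_pro_p_group p S T x" and "prime p"
    and H: "group H" "finite (carrier H)" "order H = p ^ k"
    and y: "range y \<subseteq> carrier H" "finite {i. y i \<noteq> \<one>\<^bsub>H\<^esub>}"
  obtains h where "discrete_hom S H h T" "\<And>i. h (x i) = y i"
proof -
  define emb :: "'u \<Rightarrow> (nat + 'i) set" where "emb u = {Inl (to_nat u)}" for u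
  have inj: "inj emb"
    by (auto simp: emb_def inj_def)
  define dec where "dec = inv_into UNIV emb"
  have dec_emb [simp]: "dec (emb u) = u" for u
    using inj by (simp add: dec_def)
  define H' where "H' = \<lparr>carrier = emb ` carrier H,
    mult = (\<lambda>A B. emb (dec A \<otimes>\<^bsub>H\<^esub> dec B)), one = emb \<one>\<^bsub>H\<^esub>\<rparr>"
  have iso: "emb \<in> iso H H'"
    using inj by (auto simp: iso_def hom_def bij_betw_def H'_def inj_on_def)
  \<comment> \<open>\<open>iso_imp_img_group\<close> delivers the image group with its unit
    overwritten; \<open>H'\<close> already has that unit.\<close>
  have "H'\<lparr>one := emb \<one>\<^bsub>H\<^esub>\<rparr> = H'"
    by (simp add: H'_def)
  then have H': "group H'"
    using group.iso_imp_img_group[OF H(1) iso] by simp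
  have order: "order H' = p ^ k" and fin: "finite (carrier H')"
    using H card_image[of emb "carrier H"] inj
    by (auto simp: order_def H'_def inj_on_def)
  let ?T = "discrete_topology (carrier H')"
  \<comment> \<open>Every subgroup contains the unit, so finite support of y suffices.\<close>
  have "converges_to_one H' ?T (emb \<circ> y)"
    unfolding converges_to_one_def
  proof (intro conjI allI impI)
    show "range (emb \<circ> y) \<subseteq> carrier H'"
      using y(1) by (auto simp: H'_def)
    fix U assume "subgroup U H' \<and> openin ?T U"
    then have "emb \<one>\<^bsub>H\<^esub> \<in> U"
      using subgroup.one_closed[of U H'] by (simp add: H'_def)
    then show "finite {i. (emb \<circ> y) i \<notin> U}"
      by (intro finite_subset[OF _ y(2)]) auto
  qed
  moreover have "pro_p_group p H' ?T"
    by (rule pro_p_group_discrete[OF assms(2) H' fin order])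
  ultimately have "\<exists>!\<phi>. \<phi> \<in> extensional (carrier S) \<and> \<phi> \<in> hom S H' \<and> continuous_map T ?T \<phi> \<and>
      (\<forall>i. \<phi> (x i) = (emb \<circ> y) i)"
    using free[unfolded free_pro_p_group_def, THEN conjunct2, THEN conjunct2, THEN conjunct2,
        THEN spec[of _ H'], THEN spec[of _ ?T], THEN spec[of _ "emb \<circ> y"]] by iprover
  then obtain \<phi> where "\<phi> \<in> extensional (carrier S) \<and> \<phi> \<in> hom S H' \<and> continuous_map T ?T \<phi> \<and>
      (\<forall>i. \<phi> (x i) = (emb \<circ> y) i)"
    by (rule ex1E)
  then have \<phi>: "\<phi> \<in> hom S H'" "continuous_map T ?T \<phi>" "\<And>i. \<phi> (x i) = emb (y i)"
    by simp_all
  have S: "group S" "topspace T = carrier S"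
    using free_pro_p_group_group[OF free] by simp_all
  have dec_hom: "dec \<in> hom H' H"
    using inj H(1) by (auto simp: hom_def H'_def group.is_monoid monoid.m_closed)
  have "dec \<circ> \<phi> \<in> hom S H"
    using \<phi>(1) dec_hom by (rule hom_compose)
  moreover have "continuous_map ?T (discrete_topology (carrier H)) (dec)"
    using inj by (auto simp: H'_def)
  then have "continuous_map T (discrete_topology (carrier H)) (dec \<circ> \<phi>)"
    by (rule continuous_map_compose[OF \<phi>(2)])
  ultimately have "discrete_hom S H (dec \<circ> \<phi>) T"
    using S H(1) by (simp add: discrete_hom_def discrete_hom_axioms_def group_hom_def group_hom_axioms_def)
  moreover have "(dec \<circ> \<phi>) (x i) = y i" for i
    using \<phi>(3) inj by simp
  ultimately show ?thesis by (rule that)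
qed

section \<open>Cochains and unitriangular representations\<close>

lemma topspace_quotient_topology: "topspace (quotient_topology T q) = q ` topspace T"
proof
  show "topspace (quotient_topology T q) \<subseteq> q ` topspace T"
    using openin_topspace[of "quotient_topology T q"] unfolding openin_quotient_topology by blast
  have "{t \<in> topspace T. q t \<in> q ` topspace T} = topspace T"
    by auto
  then have "openin (quotient_topology T q) (q ` topspace T)"
    by (simp add: openin_quotient_topology)
  then show "q ` topspace T \<subseteq> topspace (quotient_topology T q)"
    by (rule openin_subset)
qed

lemma continuous_map_to_quotient_topology: "continuous_map T (quotient_topology T q) q"
  by (auto simp: continuous_map_def topspace_quotient_topology openin_quotient_topology)

lemma continuous_map_from_quotient_topology:
  assumes "continuous_map T X (f \<circ> q)"
  shows "continuous_map (quotient_topology T q) X f"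
  using assms
  by (auto simp: continuous_map_def topspace_quotient_topology openin_quotient_topology)
    (smt (verit, best) Collect_cong image_eqI)

lemma carrier_Mod_eq: "carrier (S Mod N) = (\<lambda>s. N #>\<^bsub>S\<^esub> s) ` carrier S"
  by (auto simp: FactGroup_def RCOSETS_def)

section \<open>Cochain equations as congruences\<close>

lemma coboundary1_apply:
  assumes "p > 1" "g \<in> carrier G" "h \<in> carrier G"
  shows "coboundary1 p G f (g, h) = (f h - f (g \<otimes>\<^bsub>G\<^esub> h) + f g) mod int p"
proof -
  interpret residues "int p" "Fp p"
    using assms by unfold_locales auto
  show ?thesis
    using assms(2,3) unfolding coboundary1_def a_minus_def res_add_eq res_neg_eq
    by (simp add: mod_simps)
qed

lemma coboundary1_extensional: "coboundary1 p G f \<in> extensional (carrier G \<times> carrier G)"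
  by (simp add: coboundary1_def)

lemma cup_apply:
  assumes "g \<in> carrier G" "h \<in> carrier G"
  shows "cup p G f f' (g, h) = f g * f' h mod int p"
  using assms by (simp add: cup_def residue_ring_def)

lemma cup_extensional: "cup p G f f' \<in> extensional (carrier G \<times> carrier G)"
  by (simp add: cup_def)

lemma add_cochains2_apply:
  assumes "g \<in> carrier G" "h \<in> carrier G"
  shows "add_cochains2 p G z z' (g, h) = (z (g, h) + z' (g, h)) mod int p"
  using assms by (simp add: add_cochains2_def residue_ring_def)

lemma zero_cochain2_apply:
  assumes "g \<in> carrier G" "h \<in> carrier G"
  shows "zero_cochain2 p G (g, h) = 0"
  using assms by (simp add: zero_cochain2_def residue_ring_def)

lemma coboundary1_eq_cup_iff:
  assumes "p > 1"
  shows "coboundary1 p G f = cup p G f' f'' \<longleftrightarrow>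
    (\<forall>g\<in>carrier G. \<forall>h\<in>carrier G. [f h - f (g \<otimes>\<^bsub>G\<^esub> h) + f g = f' g * f'' h] (mod int p))"
    (is "?L \<longleftrightarrow> ?R")
proof
  assume ?L
  then show ?R
    using coboundary1_apply[OF assms, of _ G _ f] cup_apply[of _ G _ p f' f'']
    by (auto simp: cong_def)
next
  assume R: ?R
  show ?L
    by (rule extensionalityI[OF coboundary1_extensional cup_extensional])
      (use R in \<open>auto simp: coboundary1_apply[OF assms] cup_apply cong_def\<close>)
qed

lemma mem_H1_iff:
  assumes "p > 1"
  shows "f \<in> H1 p G T \<longleftrightarrow> f \<in> cochains1 p G T \<and>
    (\<forall>g\<in>carrier G. \<forall>h\<in>carrier G. [f (g \<otimes>\<^bsub>G\<^esub> h) = f g + f h] (mod int p))"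
proof -
  have *: "zero_cochain2 p G \<in> extensional (carrier G \<times> carrier G)"
    by (simp add: zero_cochain2_def)
  have **: "[u = v + w] (mod int p) \<longleftrightarrow> (w - u + v) mod int p = 0" for u v w :: int
    by (auto simp: cong_iff_dvd_diff mod_eq_0_iff_dvd algebra_simps dvd_diff_commute)
  have "coboundary1 p G f = zero_cochain2 p G \<longleftrightarrow>
    (\<forall>g\<in>carrier G. \<forall>h\<in>carrier G. (f h - f (g \<otimes>\<^bsub>G\<^esub> h) + f g) mod int p = 0)" (is "?L \<longleftrightarrow> ?R")
  proof
    assume ?L
    then show ?R
      using coboundary1_apply[OF assms, of _ G _ f] zero_cochain2_apply[of _ G _ p] by auto
  next
    assume R: ?R
    show ?L
      by (rule extensionalityI[OF coboundary1_extensional *])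
        (use R in \<open>auto simp: coboundary1_apply[OF assms] zero_cochain2_apply\<close>)
  qed
  then show ?thesis
    unfolding H1_def ** by auto
qed

lemma continuous_map_discrete_Pair:
  assumes "continuous_map T (discrete_topology A) f" "continuous_map T (discrete_topology B) g"
  shows "continuous_map T (discrete_topology (A \<times> B)) (\<lambda>t. (f t, g t))"
  unfolding prod_topology_discrete_topology by (rule continuous_map_pairedI[OF assms])

lemma carrier_Fp: "carrier (Fp p) = {0..<int p}"
  by (auto simp: residue_ring_def)

section \<open>Defining systems and unitriangular homomorphisms\<close>

text \<open>The equation for \<open>a 1 3\<close> says - a13(gh) = - a13(g) - a13(h) + (- a12(g)) (-
  a23(h)), which is the matrix rule for the (1,3) entry after negating all entries; likewise for
  \<open>a 2 4\<close>. The cochain f fills the corner, where \<open>cob\<close> expresses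
  multiplicativity.\<close>

lemma discrete_hom_of_defining_system:
  fixes G (structure)
  assumes "p > 1" "group G" "topspace T = carrier G"
    and \<alpha>: "\<alpha>1 \<in> H1 p G T" "\<alpha>2 \<in> H1 p G T" "\<alpha>3 \<in> H1 p G T"
    and a: "defining_system p G T \<alpha>1 \<alpha>2 \<alpha>3 a"
    and f: "f \<in> cochains1 p G T"
    and cob: "add_cochains2 p G (cup p G (a 1 2) (a 2 4)) (cup p G (a 1 3) (a 3 4)) = coboundary1 p G f"
  shows "discrete_hom G (UT4 p)
    (\<lambda>g. ut4_mod p (- \<alpha>1 g, - \<alpha>2 g, - \<alpha>3 g, - a 1 3 g, - a 2 4 g, - f g)) T"
    (is "discrete_hom G _ (\<lambda>g. ut4_mod p (?h g)) T")
proof -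
  interpret group G by fact
  have a_simps: "a 1 2 = \<alpha>1" "a 2 3 = \<alpha>2" "a 3 4 = \<alpha>3"
    and cochains: "a 1 3 \<in> cochains1 p G T" "a 2 4 \<in> cochains1 p G T"
    and cobs: "coboundary1 p G (a 1 3) = cup p G \<alpha>1 \<alpha>2" "coboundary1 p G (a 2 4) = cup p G \<alpha>2 \<alpha>3"
    using a unfolding defining_system_def by auto
  have add: "[- v = - u + - w] (mod int p)" if "[v = u + w] (mod int p)" for u v w :: int
    using cong_minus_minus_iff[THEN iffD2, OF that] by simp
  have neg: "[- v = - u + - w + z] (mod int p)" if "[w - v + u = z] (mod int p)" for u v w z :: int
    using that by (simp add: cong_iff_dvd_diff algebra_simps)
  have hom: "ut4_mod p (?h (g \<otimes> g')) = ut4_mod p (?h g) \<otimes>\<^bsub>UT4 p\<^esub> ut4_mod p (?h g')"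
    if g: "g \<in> carrier G" "g' \<in> carrier G" for g g'
  proof -
    have "[\<alpha>1 (g \<otimes> g') = \<alpha>1 g + \<alpha>1 g'] (mod int p)" "[\<alpha>2 (g \<otimes> g') = \<alpha>2 g + \<alpha>2 g'] (mod int p)"
      "[\<alpha>3 (g \<otimes> g') = \<alpha>3 g + \<alpha>3 g'] (mod int p)"
      using \<alpha> g unfolding mem_H1_iff[OF assms(1)] by auto
    note h1 = this[THEN add]
    note h2 = cobs[unfolded coboundary1_eq_cup_iff[OF assms(1)], rule_format, OF g, THEN neg]
    have "(\<alpha>1 g * a 2 4 g' mod int p + a 1 3 g * \<alpha>3 g' mod int p) mod int p =
        (f g' - f (g \<otimes> g') + f g) mod int p"
      using fun_cong[OF cob[unfolded a_simps], of "(g, g')"] g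
      by (simp add: add_cochains2_apply cup_apply coboundary1_apply[OF assms(1)])
    then have "[f g' - f (g \<otimes> g') + f g = \<alpha>1 g * a 2 4 g' + a 1 3 g * \<alpha>3 g'] (mod int p)"
      by (simp add: cong_def mod_simps)
    then have h3: "[- f (g \<otimes> g') = - f g + - f g' + (\<alpha>1 g * a 2 4 g' + a 1 3 g * \<alpha>3 g')] (mod int p)"
      by (rule neg)
    show ?thesis
      unfolding UT4_mult ut4_mod_mult_left ut4_mod_mult_right
      using h1 h2 h3 by (simp add: cong_def add.assoc)
  qed
  have cont: "continuous_map T (discrete_topology {0..<int p}) \<phi>" if "\<phi> \<in> cochains1 p G T" for \<phi>
    using that by (simp add: cochains1_def carrier_Fp)
  let ?D = "{0..<int p} \<times> {0..<int p} \<times> {0..<int p} \<times> {0..<int p} \<times> {0..<int p} \<times> {0..<int p}"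
  have "continuous_map T (discrete_topology ?D) (\<lambda>g. (\<alpha>1 g, \<alpha>2 g, \<alpha>3 g, a 1 3 g, a 2 4 g, f g))"
    using \<alpha> cochains f unfolding mem_H1_iff[OF assms(1)]
    by (intro continuous_map_discrete_Pair cont) auto
  \<comment> \<open>Any map out of a discrete space is continuous, so only the tuple of cochains
    needs an argument.\<close>
  moreover have "continuous_map (discrete_topology ?D) (discrete_topology (carrier (UT4 p)))
      (\<lambda>(u, v, w, x, y, z). ut4_mod p (- u, - v, - w, - x, - y, - z))"
    using assms(1) by (auto simp: UT4_carrier)
  ultimately have "continuous_map T (discrete_topology (carrier (UT4 p)))
      ((\<lambda>(u, v, w, x, y, z). ut4_mod p (- u, - v, - w, - x, - y, - z)) \<circ>
       (\<lambda>g. (\<alpha>1 g, \<alpha>2 g, \<alpha>3 g, a 1 3 g, a 2 4 g, f g)))"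
    by (rule continuous_map_compose)
  then have "continuous_map T (discrete_topology (carrier (UT4 p))) (\<lambda>g. ut4_mod p (?h g))"
    by (simp only: comp_def prod.case)
  moreover have "(\<lambda>g. ut4_mod p (?h g)) \<in> hom G (UT4 p)"
    using assms(1) hom by (auto intro!: homI ut4_mod_carrier simp del: ut4_mod.simps)
  ultimately show ?thesis
    using assms group_UT4[of p]
    by (simp add: discrete_hom_def discrete_hom_axioms_def group_hom_def group_hom_axioms_def)
qed

text \<open>Matrices with only a corner entry are central, so conjugation fixes each of
  them.\<close>

lemma UT4_level_3_normal:
  assumes "p > 0"
  shows "UT4_level p 3 \<lhd> UT4 p"
proof -
  interpret group "UT4 p" by (rule group_UT4[OF assms])
  have comm: "x \<otimes>\<^bsub>UT4 p\<^esub> z = z \<otimes>\<^bsub>UT4 p\<^esub> x" if "z \<in> UT4_level p 3" for x z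
    using that by (cases x; cases z) (auto simp: UT4_level_def UT4_mult add.commute)
  show ?thesis
    unfolding normal_inv_iff
  proof (intro conjI ballI subgroup_UT4_level assms)
    fix x z assume "x \<in> carrier (UT4 p)" and z: "z \<in> UT4_level p 3"
    moreover have "z \<in> carrier (UT4 p)"
      using z by (auto simp: UT4_level_def)
    ultimately show "x \<otimes>\<^bsub>UT4 p\<^esub> z \<otimes>\<^bsub>UT4 p\<^esub> inv\<^bsub>UT4 p\<^esub> x \<in> UT4_level p 3"
      unfolding comm[OF z] by (simp add: m_assoc)
  qed
qed

text \<open>Multiplication by a corner matrix changes only the corner, so the other five entries of
  h are constant on cosets of N and descend to the quotient. The corner entry need not descend, so
  the result is a defining system only.\<close>

lemma defining_system_of_discrete_hom:
  fixes S (structure)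
  assumes h: "discrete_hom S (UT4 p) h T" and "p > 1"
    and N: "N \<lhd> S" "h ` N \<subseteq> UT4_level p 3"
  defines "G \<equiv> S Mod N" and "TG \<equiv> quotient_topology T (\<lambda>s. N #> s)"
  obtains \<alpha>1 \<alpha>2 \<alpha>3 a where "\<alpha>1 \<in> H1 p G TG" "\<alpha>2 \<in> H1 p G TG" "\<alpha>3 \<in> H1 p G TG"
    "defining_system p G TG \<alpha>1 \<alpha>2 \<alpha>3 a"
    "\<forall>s\<in>carrier S. \<alpha>1 (N #> s) = - fst (h s) mod int p"
    "\<forall>s\<in>carrier S. \<alpha>2 (N #> s) = - fst (snd (h s)) mod int p"
    "\<forall>s\<in>carrier S. \<alpha>3 (N #> s) = - fst (snd (snd (h s))) mod int p"
proof -
  interpret discrete_hom S "UT4 p" h T by fact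
  interpret normal N S by fact
  define rep where "rep C = (SOME s. s \<in> carrier S \<and> N #> s = C)" for C
  define coch where "coch \<pi> = (\<lambda>C \<in> carrier G. (- \<pi> (h (rep C))) mod int p)" for \<pi> :: "ut4 \<Rightarrow> int"
  \<comment> \<open>Invariance under left multiplication fits the right cosets \<open>N #> s\<close>
    and makes \<open>coch\<close> independent of the choice in \<open>rep\<close>.\<close>
  define inv5 where "inv5 \<pi> \<longleftrightarrow> (\<forall>z\<in>UT4_level p 3. \<forall>u\<in>carrier (UT4 p). \<pi> (z \<otimes>\<^bsub>UT4 p\<^esub> u) = \<pi> u)"
    for \<pi> :: "ut4 \<Rightarrow> int"
  have carrier_G: "carrier G = (\<lambda>s. N #> s) ` carrier S"
    by (simp add: G_def carrier_Mod_eq)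
  have G_mult: "(N #> s) \<otimes>\<^bsub>G\<^esub> (N #> t) = N #> (s \<otimes> t)" if "s \<in> carrier S" "t \<in> carrier S" for s t
    using that by (simp add: G_def FactGroup_def rcos_sum)
  have coch: "coch \<pi> (N #> s) = (- \<pi> (h s)) mod int p" if "inv5 \<pi>" "s \<in> carrier S" for \<pi> s
  proof -
    have "rep (N #> s) \<in> carrier S \<and> N #> rep (N #> s) = N #> s"
      unfolding rep_def
      by (rule someI[of "\<lambda>t. t \<in> carrier S \<and> N #> t = N #> s" s]) (simp add: that(2))
    then have r: "rep (N #> s) \<in> carrier S" and "rep (N #> s) \<in> N #> s"
      using G.rcos_self[OF _ subgroup_axioms] by auto
    then obtain n where n: "n \<in> N" "rep (N #> s) = n \<otimes> s"
      unfolding r_coset_def by auto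
    then have "h (rep (N #> s)) = h n \<otimes>\<^bsub>UT4 p\<^esub> h s"
      using that(2) by simp
    then have "\<pi> (h (rep (N #> s))) = \<pi> (h s)"
      using that n N(2) unfolding inv5_def by auto
    then show ?thesis
      using that(2) by (simp add: coch_def carrier_G)
  qed
  have cochains: "coch \<pi> \<in> cochains1 p G TG" if "inv5 \<pi>" for \<pi>
  proof -
    have "continuous_map (discrete_topology (carrier (UT4 p))) (discrete_topology (carrier (Fp p)))
        (\<lambda>u. (- \<pi> u) mod int p)"
      using assms(2) by (auto simp: carrier_Fp)
    then have "continuous_map T (discrete_topology (carrier (Fp p))) ((\<lambda>u. (- \<pi> u) mod int p) \<circ> h)"
      by (rule continuous_map_compose[OF cont])
    then have "continuous_map T (discrete_topology (carrier (Fp p))) (coch \<pi> \<circ> (\<lambda>s. N #> s))"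
      by (rule continuous_map_eq) (use that in \<open>auto simp: topspace_eq coch\<close>)
    then show ?thesis
      unfolding cochains1_def TG_def
      by (auto intro: continuous_map_from_quotient_topology simp: coch_def)
  qed
  define a12 a23 a34 a13 a24 where
    a_defs: "a12 = coch (\<lambda>(a, b, c, d, e, f). a)" "a23 = coch (\<lambda>(a, b, c, d, e, f). b)"
      "a34 = coch (\<lambda>(a, b, c, d, e, f). c)" "a13 = coch (\<lambda>(a, b, c, d, e, f). d)"
      "a24 = coch (\<lambda>(a, b, c, d, e, f). e)"
  have inv5: "inv5 (\<lambda>(a, b, c, d, e, f). a)" "inv5 (\<lambda>(a, b, c, d, e, f). b)"
    "inv5 (\<lambda>(a, b, c, d, e, f). c)" "inv5 (\<lambda>(a, b, c, d, e, f). d)" "inv5 (\<lambda>(a, b, c, d, e, f). e)"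
    unfolding inv5_def by (auto simp: UT4_level_def UT4_mult UT4_carrier)
  have C: "a12 \<in> cochains1 p G TG" "a23 \<in> cochains1 p G TG" "a34 \<in> cochains1 p G TG"
    "a13 \<in> cochains1 p G TG" "a24 \<in> cochains1 p G TG"
    unfolding a_defs by (intro cochains inv5)+
  have add: "[(- ((u + v) mod int p)) mod int p = (- u) mod int p + (- v) mod int p] (mod int p)"
    for u v
    by (simp add: cong_def mod_simps)
  have neg_mod: "[(- (u mod int p)) mod int p = - u] (mod int p)" for u
    by (simp add: cong_def mod_simps)
  \<comment> \<open>After stripping the reductions, the left side is x * y and the two signs on the
    right cancel.\<close>
  have cup: "[(- v) mod int p - (- ((u + v + x * y) mod int p)) mod int p + (- u) mod int p =
      (- x) mod int p * ((- y) mod int p)] (mod int p)" for u v x y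
  proof -
    have "[(- v) mod int p - (- ((u + v + x * y) mod int p)) mod int p + (- u) mod int p =
      - v - (- (u + v + x * y)) + (- u)] (mod int p)"
      by (intro cong_add cong_diff neg_mod) simp_all
    also have "- v - (- (u + v + x * y)) + (- u) = (- x) * (- y)"
      by simp
    also have "[(- x) * (- y) = (- x) mod int p * ((- y) mod int p)] (mod int p)"
      by (intro cong_mult) simp_all
    finally show ?thesis .
  qed
  have H: "a12 \<in> H1 p G TG" "a23 \<in> H1 p G TG" "a34 \<in> H1 p G TG"
  proof -
    have "[coch \<pi> (g \<otimes>\<^bsub>G\<^esub> g') = coch \<pi> g + coch \<pi> g'] (mod int p)"
      if g: "g \<in> carrier G" "g' \<in> carrier G" and "inv5 \<pi>"
        "\<And>u v. \<pi> (u \<otimes>\<^bsub>UT4 p\<^esub> v) = (\<pi> u + \<pi> v) mod int p" for g g' \<pi>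
    proof -
      obtain s t where st: "g = N #> s" "g' = N #> t" "s \<in> carrier S" "t \<in> carrier S"
        using g carrier_G by auto
      then show ?thesis
        by (simp only: G_mult coch[OF that(3)] G.m_closed hom_mult that(4) add)
    qed
    then show "a12 \<in> H1 p G TG" "a23 \<in> H1 p G TG" "a34 \<in> H1 p G TG"
      using C inv5 unfolding mem_H1_iff[OF assms(2)] a_defs by (auto simp: UT4_mult)
  qed
  have cob: "coboundary1 p G (coch \<pi>) = cup p G (coch \<pi>') (coch \<pi>'')"
    if "inv5 \<pi>" "inv5 \<pi>'" "inv5 \<pi>''"
      "\<And>u v. \<pi> (u \<otimes>\<^bsub>UT4 p\<^esub> v) = (\<pi> u + \<pi> v + \<pi>' u * \<pi>'' v) mod int p" for \<pi> \<pi>' \<pi>''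
    unfolding coboundary1_eq_cup_iff[OF assms(2)]
  proof (intro ballI)
    fix g g' assume "g \<in> carrier G" "g' \<in> carrier G"
    then obtain s t where st: "g = N #> s" "g' = N #> t" "s \<in> carrier S" "t \<in> carrier S"
      using carrier_G by auto
    then show "[coch \<pi> g' - coch \<pi> (g \<otimes>\<^bsub>G\<^esub> g') + coch \<pi> g = coch \<pi>' g * coch \<pi>'' g'] (mod int p)"
      by (simp only: G_mult coch that G.m_closed hom_mult cup)
  qed
  \<comment> \<open>A defining system is read only at (1,2), (2,3), (3,4), (1,3) and (2,4);
    elsewhere the values are arbitrary.\<close>
  define a :: "nat \<Rightarrow> nat \<Rightarrow> 'a set \<Rightarrow> int" where
    "a k l = (if k = 1 \<and> l = 2 then a12 else if k = 2 \<and> l = 3 then a23 else if k = 3 then a34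
      else if k = 1 then a13 else a24)" for k l
  have "coboundary1 p G a13 = cup p G a12 a23" "coboundary1 p G a24 = cup p G a23 a34"
    unfolding a_defs by (rule cob; use inv5 in \<open>auto simp: UT4_mult\<close>)+
  then have "defining_system p G TG a12 a23 a34 a"
    unfolding defining_system_def using C by (simp add: a_def)
  then show ?thesis
    by (rule that[OF H]) (auto simp: a_defs coch[OF inv5(1)] coch[OF inv5(2)] coch[OF inv5(3)] split: prod.splits)
qed

section \<open>Images of canonical decompositions\<close>

lemma linear_order_on_le: "linear_order_on UNIV {(i, j::'i::linorder). i \<le> j}"
  by (auto simp: order_on_defs refl_on_def trans_def antisym_def total_on_def)

text \<open>All factors die except the product of triple commutators, where one index triple
  survives. \<open>squares\<close> and \<open>comms\<close> are hypotheses because they hold for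
  different reasons for r and for the other relators.\<close>

lemma canonical_decomposition_image:
  fixes S (structure) and x :: "'i::wellorder \<Rightarrow> 'a"
  assumes h: "discrete_hom S (UT4 p) h T" and p: "prime p" and x: "range x \<subseteq> carrier S"
    and L2: "linear_order_on pair_indices L2" and L3: "linear_order_on triple_indices L3"
    and ij: "i < j" and mn: "m = i \<and> n = j \<or> m = j \<and> n = i"
    and superdiag: "\<And>k. \<exists>d e f. h (x k) = (of_bool (k = m), of_bool (k = m), of_bool (k = n), d, e, f)"
    and dec: "canonical_decomposition p S T x L2 L3 s a b c"
    and squares: "\<And>k. p = 2 \<Longrightarrow> h (x k) [^]\<^bsub>UT4 p\<^esub> (p * a k) = \<one>\<^bsub>UT4 p\<^esub>"
    and comms: "\<And>k l. k < l \<Longrightarrow>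
      commutator (UT4 p) (h (x k)) (h (x l)) [^]\<^bsub>UT4 p\<^esub> b k l = \<one>\<^bsub>UT4 p\<^esub>"
  shows "h s = ut4_mod p (0, 0, 0, 0, 0, (if m = i then - int (c i j m) else int (c i j m)))"
proof -
  interpret discrete_hom S "UT4 p" h T by fact
  have p1: "p > 1" using p prime_gt_1_nat by blast
  have xS: "x k \<in> carrier S" for k
    using x by auto
  have "m \<noteq> n" using ij mn by auto
  \<comment> \<open>Modulo 3 a cube retains only the corner term a*b*c, and no generator has three
    nonzero superdiagonal entries.\<close>
  have cubes: "h (x k) [^]\<^bsub>UT4 p\<^esub> (p * a k) = \<one>\<^bsub>UT4 p\<^esub>" if "p = 3" for k
  proof -
    obtain d e f where k: "h (x k) = (of_bool (k = m), of_bool (k = m), of_bool (k = n), d, e, f)"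
      using superdiag by blast
    have "h (x k) [^]\<^bsub>UT4 p\<^esub> (3 :: nat) = \<one>\<^bsub>UT4 p\<^esub>"
      unfolding k UT4_pow that UT4_one using \<open>m \<noteq> n\<close>
      by (auto simp: numeral_eq_Suc)
    then have "(h (x k) [^]\<^bsub>UT4 p\<^esub> (3 :: nat)) [^]\<^bsub>UT4 p\<^esub> a k = \<one>\<^bsub>UT4 p\<^esub>"
      by simp
    moreover have "h (x k) \<in> carrier (UT4 p)"
      using xS by simp
    ultimately show ?thesis
      using H.nat_pow_pow[of "h (x k)" 3 "a k"] by (simp only: that)
  qed
  obtain A B C r' where
    A: "has_ordered_prod S T {(i, j). i \<le> j} (\<lambda>i. x i [^] (p * a i)) UNIV A" and
    B: "has_ordered_prod S T L2 (\<lambda>(i, j). commutator S (x i) (x j) [^] b i j) pair_indices B" and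
    C: "has_ordered_prod S T L3
      (\<lambda>(i, j, k). commutator S (commutator S (x i) (x j)) (x k) [^] c i j k) triple_indices C" and
    r': "r' \<in> zassenhaus p S T 4" and
    s: "s = (if p = 2 then A \<otimes> B \<otimes> C \<otimes> r' else if p = 3 then B \<otimes> A \<otimes> C \<otimes> r' else B \<otimes> C \<otimes> r')"
    using dec unfolding canonical_decomposition_def by (elim conjE exE) (rule that)
  have hA: "h A = \<one>\<^bsub>UT4 p\<^esub>" if "p = 2 \<or> p = 3"
  proof -
    have "h (x k [^] (p * a k)) = \<one>\<^bsub>UT4 p\<^esub>" for k
      using that squares[of k] cubes[of k] xS[of k] by (auto simp: hom_nat_pow)
    \<comment> \<open>All factors are trivial, so the distinguished index may be any; i is
      chosen.\<close>
    then show ?thesis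
      using has_ordered_prod_image(1)[OF A linear_order_on_le, of i] xS by auto
  qed
  have hB: "h B = \<one>\<^bsub>UT4 p\<^esub>"
  proof -
    have "h (commutator S (x k) (x l) [^] b k l) = \<one>\<^bsub>UT4 p\<^esub>" if "k < l" for k l
      using comms[OF that] xS by (simp add: hom_nat_pow hom_commutator)
    moreover from this have "h B = h ((\<lambda>(i, j). commutator S (x i) (x j) [^] b i j) (i, j))"
      by (intro has_ordered_prod_image(1)[OF B L2]) (use xS ij in \<open>auto simp: pair_indices_def\<close>)
    ultimately show ?thesis
      using ij by simp
  qed
  \<comment> \<open>Every generator has a = b, so a*b' - a'*b vanishes and - a''*(b*c' - b'*c)
    remains. It is nonzero exactly for o' = m and {k, l} = {m, n}.\<close>
  have triple: "h (commutator S (commutator S (x k) (x l)) (x o')) =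
      ut4_mod p (0, 0, 0, 0, 0, - (of_bool (o' = m) *
        (of_bool (k = m \<and> l = n) - of_bool (l = m \<and> k = n))))" for k l o'
  proof -
    obtain d e f where k: "h (x k) = (of_bool (k = m), of_bool (k = m), of_bool (k = n), d, e, f)"
      using superdiag by blast
    obtain d' e' f' where l: "h (x l) = (of_bool (l = m), of_bool (l = m), of_bool (l = n), d', e', f')"
      using superdiag by blast
    obtain d'' e'' f'' where o': "h (x o') = (of_bool (o' = m), of_bool (o' = m), of_bool (o' = n), d'', e'', f'')"
      using superdiag by blast
    have "h (x k) \<in> carrier (UT4 p)" "h (x l) \<in> carrier (UT4 p)" "h (x o') \<in> carrier (UT4 p)"
      using xS by auto
    then have "commutator (UT4 p) (commutator (UT4 p) (h (x k)) (h (x l))) (h (x o')) =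
      ut4_mod p (0, 0, 0, 0, 0, - (of_bool (o' = m) *
        (of_bool (k = m \<and> l = n) - of_bool (l = m \<and> k = n))))"
      using p1 unfolding k l o' by (subst UT4_commutator_commutator) (auto simp: of_bool_conj)
    then show ?thesis
      by (simp only: hom_commutator xS G.commutator_closed)
  qed
  have pow: "ut4_mod p (0, 0, 0, 0, 0, z) [^]\<^bsub>UT4 p\<^esub> q = ut4_mod p (0, 0, 0, 0, 0, int q * z)"
    for q :: nat and z
    using UT4_pow[where a = 0 and b = 0 and c = 0 and d = 0 and e = 0 and f = "z mod int p"] by (simp add: mod_simps)
  have hC: "h C = ut4_mod p (0, 0, 0, 0, 0, (if m = i then - int (c i j m) else int (c i j m)))"
  proof -
    have others: "h (commutator S (commutator S (x k) (x l)) (x o') [^] c k l o') = \<one>\<^bsub>UT4 p\<^esub>"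
      if "k < l" "(k, l, o') \<noteq> (i, j, m)" for k l o'
    proof -
      have "h (commutator S (commutator S (x k) (x l)) (x o')) = \<one>\<^bsub>UT4 p\<^esub>"
      proof -
        \<comment> \<open>Since k < l, the pair {i, j} occurs only as (i, j), which leaves (i, j, m)
          as the sole survivor.\<close>
        have "\<not> (k = j \<and> l = i)"
          using that(1) ij by auto
        have zero: "of_bool (o' = m) * (of_bool (k = m \<and> l = n) - of_bool (l = m \<and> k = n)) = (0 :: int)"
          using that(2) mn \<open>\<not> (k = j \<and> l = i)\<close> by (elim disjE conjE) auto
        show ?thesis
          unfolding triple zero UT4_one by simp
      qed
      then show ?thesis
        using xS by (simp add: hom_nat_pow)
    qed
    have "h C = h ((\<lambda>(i, j, k). commutator S (commutator S (x i) (x j)) (x k) [^] c i j k) (i, j, m))"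
    proof (rule has_ordered_prod_image(1)[OF C L3])
      show "(\<lambda>(i, j, k). commutator S (commutator S (x i) (x j)) (x k) [^] c i j k) ` triple_indices
          \<subseteq> carrier S"
        using xS by auto
      show "(i, j, m) \<in> triple_indices"
        using ij mn by (auto simp: triple_indices_def)
      show "h ((\<lambda>(i, j, k). commutator S (commutator S (x i) (x j)) (x k) [^] c i j k) t) = \<one>\<^bsub>UT4 p\<^esub>"
        if "t \<in> triple_indices" "t \<noteq> (i, j, m)" for t
        using that others by (cases t) (simp add: triple_indices_def)
    qed
    also have "\<dots> = h (commutator S (commutator S (x i) (x j)) (x m)) [^]\<^bsub>UT4 p\<^esub> c i j m"
      using xS by (simp add: hom_nat_pow)
    also have "\<dots> = ut4_mod p (0, 0, 0, 0, 0, int (c i j m) * - (of_bool (m = m) *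
        (of_bool (i = m \<and> j = n) - of_bool (j = m \<and> i = n))))"
      unfolding triple pow ..
    also have "int (c i j m) * - (of_bool (m = m) *
        (of_bool (i = m \<and> j = n) - of_bool (j = m \<and> i = n))) =
        (if m = i then - int (c i j m) else int (c i j m))"
    proof -
      have "(i = m \<and> j = n) = (m = i)" "(j = m \<and> i = n) = (m \<noteq> i)"
        using mn \<open>m \<noteq> n\<close> by metis+
      then show ?thesis
        by simp
    qed
    finally show ?thesis .
  qed
  have "h r' \<in> UT4_level p 4"
    using zassenhaus_UT4_level[OF h p, of 4] r' by auto
  then have hr': "h r' = \<one>\<^bsub>UT4 p\<^esub>"
    by (auto simp: UT4_level_def UT4_one)
  have carr: "A \<in> carrier S" "B \<in> carrier S" "C \<in> carrier S" "r' \<in> carrier S"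
    using limitin_topspace[OF A[unfolded has_ordered_prod_def]]
      limitin_topspace[OF B[unfolded has_ordered_prod_def]]
      limitin_topspace[OF C[unfolded has_ordered_prod_def]]
      subsetD[OF zassenhaus_subset_carrier[OF topspace_eq] r'] topspace_eq by auto
  have "h (B \<otimes> C \<otimes> r') = h C"
    using carr hB hr' by simp
  moreover have "h (A \<otimes> B \<otimes> C \<otimes> r') = h C" "h (B \<otimes> A \<otimes> C \<otimes> r') = h C" if "p = 2 \<or> p = 3"
    using carr hA[OF that] hB hr' by simp_all
  ultimately have "h s = h C"
    unfolding s by (simp only: split: if_split) blast
  then show ?thesis
    using hC by simp
qed

section \<open>Normal closures and vanishing classes of degree two\<close>

lemma (in group) closed_normal_subgroup_generated_normal:
  assumes "topspace T = carrier G" "A \<subseteq> carrier G"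
  shows "closed_normal_subgroup_generated G T A \<lhd> G" "A \<subseteq> closed_normal_subgroup_generated G T A"
proof -
  have "carrier G \<lhd> G"
    unfolding normal_inv_iff by (auto intro: subgroup_self)
  moreover have "closedin T (carrier G)"
    using assms(1) by (metis closedin_topspace)
  \<comment> \<open>The intersection of an empty family would be \<open>UNIV\<close>, so a member
    must be exhibited.\<close>
  ultimately have ne: "{N. N \<lhd> G \<and> closedin T N \<and> A \<subseteq> N} \<noteq> {}"
    using assms(2) by blast
  have "subgroup (\<Inter>{N. N \<lhd> G \<and> closedin T N \<and> A \<subseteq> N}) G"
    using ne by (intro subgroups_Inter) (auto simp: normal_inv_iff)
  then show "closed_normal_subgroup_generated G T A \<lhd> G"
    unfolding closed_normal_subgroup_generated_def normal_inv_iff[of "\<Inter>_"]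
    by (auto simp: normal_inv_iff)
  show "A \<subseteq> closed_normal_subgroup_generated G T A"
    unfolding closed_normal_subgroup_generated_def by auto
qed

text \<open>The cochain lies in its own class, by adding the coboundary of 0, hence in the class of
  0. Writing it as a sum ensures that its values are already reduced modulo p.\<close>

lemma coboundary_of_class2_eq_zero:
  assumes "p > 1" "group G" "topspace T = carrier G"
    and "class2 p G T (add_cochains2 p G z z') = class2 p G T (zero_cochain2 p G)"
  obtains f where "f \<in> cochains1 p G T" "add_cochains2 p G z z' = coboundary1 p G f"
proof -
  define f0 where "f0 = (\<lambda>g \<in> carrier G. 0 :: int)"
  have "continuous_map T (discrete_topology (carrier (Fp p))) f0"
    by (rule continuous_map_eq[of _ _ "\<lambda>_. 0"])
      (use assms in \<open>auto simp: f0_def carrier_Fp\<close>)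
  then have "f0 \<in> cochains1 p G T"
    by (simp add: cochains1_def f0_def)
  moreover have "add_cochains2 p G z z' = add_cochains2 p G (add_cochains2 p G z z') (coboundary1 p G f0)"
    (is "?u = ?v")
  proof (rule extensionalityI[of _ "carrier G \<times> carrier G"])
    show "?u \<in> extensional (carrier G \<times> carrier G)" "?v \<in> extensional (carrier G \<times> carrier G)"
      by (simp_all add: add_cochains2_def)
    fix t assume "t \<in> carrier G \<times> carrier G"
    then obtain g h where t: "t = (g, h)" "g \<in> carrier G" "h \<in> carrier G"
      by auto
    have "g \<otimes>\<^bsub>G\<^esub> h \<in> carrier G"
      using t assms(2) by (simp add: group.is_monoid monoid.m_closed)
    then show "?u t = ?v t"
      using t by (simp add: add_cochains2_apply coboundary1_apply[OF assms(1)] f0_def)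
  qed
  ultimately have "add_cochains2 p G z z' \<in> class2 p G T (add_cochains2 p G z z')"
    unfolding class2_def by blast
  then have "add_cochains2 p G z z' \<in> class2 p G T (zero_cochain2 p G)"
    by (simp only: assms(4))
  then obtain f where f: "f \<in> cochains1 p G T"
      "add_cochains2 p G z z' = add_cochains2 p G (zero_cochain2 p G) (coboundary1 p G f)"
    unfolding class2_def by blast
  have "add_cochains2 p G (zero_cochain2 p G) (coboundary1 p G f) = coboundary1 p G f"
    (is "?u = ?v")
  proof (rule extensionalityI[OF _ coboundary1_extensional])
    show "?u \<in> extensional (carrier G \<times> carrier G)"
      by (simp add: add_cochains2_def)
    show "?u t = ?v t" if "t \<in> carrier G \<times> carrier G" for t
      using that by (auto simp: add_cochains2_apply zero_cochain2_apply coboundary1_apply[OF assms(1)])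
  qed
  then show ?thesis
    using f that by simp
qed

section \<open>Nonvanishing of the triple Massey product\<close>

theorem theorem7p12:
  fixes p :: nat
    and S :: "('a, 'm) monoid_scheme" and T :: "'a topology"
    and x :: "'i::wellorder \<Rightarrow> 'a"
    and L2 :: "('i \<times> 'i) rel" and L3 :: "('i \<times> 'i \<times> 'i) rel"
    and R :: "'a set" and r :: 'a and i j m :: 'i
    and a :: "'i \<Rightarrow> nat" and b :: "'i \<Rightarrow> 'i \<Rightarrow> nat" and c :: "'i \<Rightarrow> 'i \<Rightarrow> 'i \<Rightarrow> nat"
  assumes "prime p"
    and "free_pro_p_group p S T x"
    and "linear_order_on pair_indices L2" and "linear_order_on triple_indices L3"
    and "R \<subseteq> zassenhaus p S T 2"
    and "r \<in> R" and "i < j"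
    and "m = i \<or> m = j"
    and "canonical_decomposition p S T x L2 L3 r a b c"
    and "u_coeff b i j = 0"
    and "\<forall>l. l \<noteq> i \<and> l \<noteq> j \<longrightarrow> u_coeff b i l = 0 \<and> u_coeff b j l = 0"
    and "c i j m \<noteq> 0"
    and "p = 2 \<longrightarrow> a i = 0 \<and> a j = 0"
    and "\<forall>s \<in> R - {r}. \<exists>a' b' c'. canonical_decomposition p S T x L2 L3 s a' b' c' \<and>
           b' i j = 0 \<and> (p = 2 \<longrightarrow> a' m = 0)"
  shows "\<not> vanishing_triple_massey p
           (S Mod closed_normal_subgroup_generated S T R)
           (quotient_topology T (\<lambda>s. closed_normal_subgroup_generated S T R #>\<^bsub>S\<^esub> s))"
proof
  interpret S: group S
    by (rule free_pro_p_group_group(1)[OF assms(2)])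
  define N where "N = closed_normal_subgroup_generated S T R"
  define q where "q = (\<lambda>s. N #>\<^bsub>S\<^esub> s)"
  \<comment> \<open>\<open>m\<close> is the index with c i j m nonzero and n the other one, so both
    variants of the hypothesis are treated together.\<close>
  define n where "n = (if m = i then j else i)"
  let ?G = "S Mod N" and ?TG = "quotient_topology T q"
  have mn: "m = i \<and> n = j \<or> m = j \<and> n = i" and "m \<noteq> n"
    using assms(7,8) by (auto simp: n_def)
  have p: "p > 1"
    using assms(1) prime_gt_1_nat by blast
  have topS: "topspace T = carrier S" and xS: "range x \<subseteq> carrier S"
    using free_pro_p_group_group[OF assms(2)] by auto
  have RS: "R \<subseteq> carrier S"
    using assms(5) zassenhaus_subset_carrier[OF topS] by blast
  interpret N: normal N S
    unfolding N_def by (rule S.closed_normal_subgroup_generated_normal[OF topS RS])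
  have RN: "R \<subseteq> N"
    unfolding N_def by (rule S.closed_normal_subgroup_generated_normal[OF topS RS])
  have topG: "topspace ?TG = carrier ?G"
    by (simp add: topspace_quotient_topology q_def carrier_Mod_eq topS)
  have b0: "b k l = 0" if "k < l" "{k, l} \<inter> {m, n} \<noteq> {}" for k l
  proof -
    have "k = i \<or> k = j \<or> l = i \<or> l = j"
      using that mn by auto
    then show ?thesis
      using that(1) assms(7,10) assms(11)[THEN spec, of k] assms(11)[THEN spec, of l]
      by (auto simp: u_coeff_def split: if_splits)
  qed
  \<comment> \<open>Only the superdiagonal of h is prescribed: another defining system may change
    the entries d and e, and the corner is free. The claim is used both for the explicit h and for
    the hypothetical lift.\<close>
  have image_r: "h r = ut4_mod p (0, 0, 0, 0, 0, (if m = i then - int (c i j m) else int (c i j m)))"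
    if h: "discrete_hom S (UT4 p) h T"
      and superdiag: "\<And>k. \<exists>d e f. h (x k) = (of_bool (k = m), of_bool (k = m), of_bool (k = n), d, e, f)"
    for h
  proof -
    interpret h: discrete_hom S "UT4 p" h T by fact
    have hx: "h (x k) \<in> carrier (UT4 p)" for k
      using xS by (simp add: range_subsetD)
    have rest: "h (x k) \<in> UT4_level p 2" if "k \<notin> {m, n}" for k
      using superdiag[of k] hx[of k] that by (auto simp: UT4_level_def)
    show ?thesis
    proof (rule canonical_decomposition_image[OF h assms(1) xS assms(3,4,7) mn superdiag assms(9)])
      fix k assume "p = 2"
      show "h (x k) [^]\<^bsub>UT4 p\<^esub> (p * a k) = \<one>\<^bsub>UT4 p\<^esub>"
      proof (cases "k \<in> {m, n}")
        case True
        then have "a k = 0"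
          using assms(13) \<open>p = 2\<close> mn by auto
        then show ?thesis by simp
      next
        case False
        \<comment> \<open>Here p = 2, so squares from level 2 land in the trivial level 4.\<close>
        have "h (x k) [^]\<^bsub>UT4 p\<^esub> p \<in> UT4_level p (p * 2)"
          by (rule UT4_level_pow_prime[OF assms(1) rest[OF False]]) simp
        then have "h (x k) [^]\<^bsub>UT4 p\<^esub> p = \<one>\<^bsub>UT4 p\<^esub>"
          using \<open>p = 2\<close> by (auto simp: UT4_level_def UT4_one)
        then show ?thesis
          using h.H.nat_pow_pow[OF hx, of k p "a k"] by simp
      qed
    next
      fix k l :: 'i assume kl: "k < l"
      show "commutator (UT4 p) (h (x k)) (h (x l)) [^]\<^bsub>UT4 p\<^esub> b k l = \<one>\<^bsub>UT4 p\<^esub>"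
      proof (cases "{k, l} \<inter> {m, n} = {}")
        case True
        then have "commutator (UT4 p) (h (x k)) (h (x l)) \<in> UT4_level p (2 + 2)"
          using p by (intro UT4_level_commutator rest) auto
        then have "commutator (UT4 p) (h (x k)) (h (x l)) = \<one>\<^bsub>UT4 p\<^esub>"
          by (auto simp: UT4_level_def UT4_one)
        then show ?thesis by simp
      next
        case False
        then show ?thesis
          using b0[OF kl] by simp
      qed
    qed
  qed
  define y :: "'i \<Rightarrow> ut4" where
    "y k = (of_bool (k = m), of_bool (k = m), of_bool (k = n), 0, 0, 0)" for k
  have y: "range y \<subseteq> carrier (UT4 p)" "finite {k. y k \<noteq> \<one>\<^bsub>UT4 p\<^esub>}"
  proof -
    show "range y \<subseteq> carrier (UT4 p)"
      using p by (auto simp: y_def UT4_carrier)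
    show "finite {k. y k \<noteq> \<one>\<^bsub>UT4 p\<^esub>}"
      by (rule finite_subset[of _ "{m, n}"]) (auto simp: y_def UT4_one)
  qed
  have "group (UT4 p)"
    using p by (simp add: group_UT4)
  from free_pro_p_group_obtain_hom[OF assms(2,1) this finite_UT4 order_UT4 y]
  obtain h where h: "discrete_hom S (UT4 p) h T" and hx: "\<And>k. h (x k) = y k"
    by metis
  interpret h: discrete_hom S "UT4 p" h T by fact
  have superdiag: "\<exists>d e f. h (x k) = (of_bool (k = m), of_bool (k = m), of_bool (k = n), d, e, f)" for k
    by (simp add: hx y_def)
  have "h s \<in> UT4_level p 3" if "s \<in> R" for s
  proof -
    have "\<exists>z. h s = ut4_mod p (0, 0, 0, 0, 0, z)"
    proof (cases "s = r")
      case True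
      then show ?thesis
        using image_r[OF h superdiag] by blast
    next
      case False
      then obtain a' b' c' where dec: "canonical_decomposition p S T x L2 L3 s a' b' c'"
        and b': "b' i j = 0" and a': "p = 2 \<Longrightarrow> a' m = 0"
        using assms(14) \<open>s \<in> R\<close> by blast
      have "h s = ut4_mod p (0, 0, 0, 0, 0, (if m = i then - int (c' i j m) else int (c' i j m)))"
      proof (rule canonical_decomposition_image[OF h assms(1) xS assms(3,4,7) mn superdiag dec])
        fix k assume "p = 2"
        show "h (x k) [^]\<^bsub>UT4 p\<^esub> (p * a' k) = \<one>\<^bsub>UT4 p\<^esub>"
        proof (cases "k = m")
          case True
          then show ?thesis
            using a'[OF \<open>p = 2\<close>] by simp
        next
          case False
          \<comment> \<open>For k other than m the matrix \<open>y k\<close> has a = b = 0, so its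
            p-th power is trivial; only the square of x_m needs the condition on a'.\<close>
          then show ?thesis
            unfolding hx y_def UT4_pow by (simp add: UT4_one)
        qed
      next
        fix k l :: 'i assume kl: "k < l"
        show "commutator (UT4 p) (h (x k)) (h (x l)) [^]\<^bsub>UT4 p\<^esub> b' k l = \<one>\<^bsub>UT4 p\<^esub>"
        proof (cases "k = i \<and> l = j")
          case True
          then show ?thesis
            using b' by simp
        next
          case False
          have "h (x k) \<in> carrier (UT4 p)" "h (x l) \<in> carrier (UT4 p)"
            using xS by (simp_all add: range_subsetD)
          \<comment> \<open>As k < l and (k, l) is not (i, j), one of the two indices lies outside
            {m, n}, and its generator maps to the unit.\<close>
          then have "commutator (UT4 p) (h (x k)) (h (x l)) = \<one>\<^bsub>UT4 p\<^esub>"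
            using p kl False mn assms(7) unfolding hx y_def
            by (subst UT4_commutator) (auto simp: UT4_one)
          then show ?thesis by simp
        qed
      qed
      then show ?thesis by blast
    qed
    then show ?thesis
      using p by (auto simp: UT4_level_def UT4_carrier)
  qed
  then have "h ` N \<subseteq> UT4_level p 3"
    unfolding N_def
    using p by (intro h.closed_normal_subgroup_generated_image UT4_level_3_normal RS) auto
  then obtain \<alpha>1 \<alpha>2 \<alpha>3 a0 where \<alpha>: "\<alpha>1 \<in> H1 p ?G ?TG" "\<alpha>2 \<in> H1 p ?G ?TG" "\<alpha>3 \<in> H1 p ?G ?TG"
    and a0: "defining_system p ?G ?TG \<alpha>1 \<alpha>2 \<alpha>3 a0"
    and val: "\<forall>s\<in>carrier S. \<alpha>1 (q s) = - fst (h s) mod int p"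
      "\<forall>s\<in>carrier S. \<alpha>2 (q s) = - fst (snd (h s)) mod int p"
      "\<forall>s\<in>carrier S. \<alpha>3 (q s) = - fst (snd (snd (h s))) mod int p"
    unfolding q_def by (rule defining_system_of_discrete_hom[OF h p N.normal_axioms])
  assume "vanishing_triple_massey p (S Mod closed_normal_subgroup_generated S T R)
    (quotient_topology T (\<lambda>s. closed_normal_subgroup_generated S T R #>\<^bsub>S\<^esub> s))"
  then have "vanishing_triple_massey p ?G ?TG"
    by (simp add: N_def q_def)
  moreover have "triple_massey_product p ?G ?TG \<alpha>1 \<alpha>2 \<alpha>3 \<noteq> {}"
    using a0 unfolding triple_massey_product_def by blast
  ultimately have "class2 p ?G ?TG (zero_cochain2 p ?G) \<in> triple_massey_product p ?G ?TG \<alpha>1 \<alpha>2 \<alpha>3"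
    using \<alpha> unfolding vanishing_triple_massey_def by blast
  then obtain a1 where a1: "defining_system p ?G ?TG \<alpha>1 \<alpha>2 \<alpha>3 a1"
    and "class2 p ?G ?TG (add_cochains2 p ?G (cup p ?G (a1 1 2) (a1 2 4)) (cup p ?G (a1 1 3) (a1 3 4))) =
      class2 p ?G ?TG (zero_cochain2 p ?G)"
    unfolding triple_massey_product_def by force
  then obtain f where f: "f \<in> cochains1 p ?G ?TG" and cob:
      "add_cochains2 p ?G (cup p ?G (a1 1 2) (a1 2 4)) (cup p ?G (a1 1 3) (a1 3 4)) = coboundary1 p ?G f"
    using coboundary_of_class2_eq_zero[OF p N.factorgroup_is_group topG] by blast
  \<comment> \<open>A vanishing value would complete a defining system with the same superdiagonal
    to a homomorphism into the full unitriangular group.\<close>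
  define h1 where "h1 g = ut4_mod p (- \<alpha>1 g, - \<alpha>2 g, - \<alpha>3 g, - a1 1 3 g, - a1 2 4 g, - f g)" for g
  have h1: "discrete_hom ?G (UT4 p) h1 ?TG"
    unfolding h1_def
    by (rule discrete_hom_of_defining_system[OF p N.factorgroup_is_group topG \<alpha> a1 f cob])
  interpret h1: discrete_hom ?G "UT4 p" h1 ?TG by (rule h1)
  have "h1 \<circ> q \<in> hom S (UT4 p)"
    unfolding q_def by (rule hom_compose[OF N.r_coset_hom_Mod h1.homh])
  moreover have "continuous_map T (discrete_topology (carrier (UT4 p))) (h1 \<circ> q)"
    by (rule continuous_map_compose[OF continuous_map_to_quotient_topology h1.cont])
  ultimately have h1q: "discrete_hom S (UT4 p) (h1 \<circ> q) T"
    using p topS group_UT4[of p]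
    by (simp add: discrete_hom_def discrete_hom_axioms_def group_hom_def group_hom_axioms_def
        S.group_axioms)
  have "\<exists>d e f. (h1 \<circ> q) (x k) = (of_bool (k = m), of_bool (k = m), of_bool (k = n), d, e, f)" for k
  proof -
    \<comment> \<open>The classes are negated entries of h and \<open>h1\<close> negates them again,
      which restores the superdiagonal of h.\<close>
    have neg: "(- ((- of_bool P) mod int p)) mod int p = of_bool P" for P
      using p by (simp add: mod_simps)
    have "x k \<in> carrier S"
      using xS by auto
    from val[rule_format, OF this] show ?thesis
      by (simp only: comp_def h1_def hx y_def fst_conv snd_conv ut4_mod.simps neg) blast
  qed
  then have "(h1 \<circ> q) r = ut4_mod p (0, 0, 0, 0, 0, (if m = i then - int (c i j m) else int (c i j m)))"
    by (rule image_r[OF h1q])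
  moreover have "q r = N"
    using RN assms(6) N.rcos_const unfolding q_def by auto
  then have "(h1 \<circ> q) r = \<one>\<^bsub>UT4 p\<^esub>"
    using h1.hom_one by simp
  \<comment> \<open>The relator r is trivial in the quotient, while \<open>image_r\<close> puts c i
    j m up to sign into the corner; a nonzero coefficient below p is not divisible by p.\<close>
  ultimately have "(if m = i then - int (c i j m) else int (c i j m)) mod int p = 0"
    by (simp add: UT4_one)
  then have "int p dvd int (c i j m)"
    by (simp add: mod_eq_0_iff_dvd split: if_splits)
  moreover have "c i j m < p"
    using assms(7,8,9) unfolding canonical_decomposition_def triple_indices_def by auto
  ultimately show False
    using assms(12) by (auto dest: nat_dvd_not_less)
qed

end
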